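(* Let $G$ be a connected graph of order $n$ with minimum degree $\delta(G)\ge 3$. If $\gamma_P(G)\ge\frac{3n}{16}$, then $\operatorname{th}_{\rm pd}^{\times}(G)=\gamma(G)$.
   Context: All graphs are finite, simple and undirected. Let $G$ be a graph. $\gamma(G)$ is the domination number: the minimum $|S|$ over $S\subseteq V(G)$ with $N[S]=V(G)$, where $N[S]$ is the closed neighborhood of $S$. For nonempty $S\subseteq V(G)$ define $P^{[0]}(S)=S$, $P^{[1]}(S)=N[S]$, and for $i\ge 1$, $P^{[i+1]}(S)=P^{[i]}(S)\cup\{w\in V(G)\setminus P^{[i]}(S): \exists u\in P^{[i]}(S),\ N(u)\setminus P^{[i]}(S)=\{w\}\}$. $S$ is a power dominating set if $P^{[t]}(S)=V(G)$ for some $t$; the power domination number $\gamma_P(G)$ is the minimum cardinality of a power dominating set. The power propagation time $\operatorname{pt}_{\rm pd}(G;S)$ is the least positive integer $t$ with $P^{[t]}(S)=V(G)$ (so it is at least $1$, even for $S=V(G)$), and is $\infty$ if $S$ is not a power dominating set. The product power throttling number is $\operatorname{th}_{\rm pd}^{\times}(G)=\min_{\emptyset\ne S\subseteq V(G)}|S|\operatorname{pt}_{\rm pd}(G;S)$. *)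

theory Defs
  imports "HOL-Library.Extended_Nat" "Graph_Theory.Graph_Theory"
begin

text \<open>
  A finite simple undirected graph is a \<^locale>\<open>pair_graph\<close>: a finite loopless digraph without
  parallel arcs whose arc set is symmetric. An edge \<open>{u, v}\<close> is thus represented by the two arcs
  \<open>(u, v)\<close> and \<open>(v, u)\<close>, so the degree of a vertex is its out-degree.
\<close>

definition min_degree :: "'a pair_pre_digraph \<Rightarrow> nat" where
  "min_degree G = Min (out_degree (with_proj G) ` pverts G)"

definition neighborhood :: "'a pair_pre_digraph \<Rightarrow> 'a \<Rightarrow> 'a set" where
  "neighborhood G u = {w. u \<rightarrow>\<^bsub>with_proj G\<^esub> w}"

definition closed_neighborhood :: "'a pair_pre_digraph \<Rightarrow> 'a set \<Rightarrow> 'a set" where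
  "closed_neighborhood G S = S \<union> (\<Union>u\<in>S. neighborhood G u)"

definition dominating_set :: "'a pair_pre_digraph \<Rightarrow> 'a set \<Rightarrow> bool" where
  "dominating_set G S \<longleftrightarrow> S \<subseteq> pverts G \<and> closed_neighborhood G S = pverts G"

definition domination_number :: "'a pair_pre_digraph \<Rightarrow> nat" where
  "domination_number G = Min (card ` {S. dominating_set G S})"

fun observed :: "'a pair_pre_digraph \<Rightarrow> 'a set \<Rightarrow> nat \<Rightarrow> 'a set" where
  "observed G S 0 = S"
| "observed G S (Suc 0) = closed_neighborhood G S"
| "observed G S (Suc (Suc i)) =
     (let P = observed G S (Suc i)
      in P \<union> {w \<in> pverts G - P. \<exists>u\<in>P. neighborhood G u - P = {w}})"

definition power_dominating_set :: "'a pair_pre_digraph \<Rightarrow> 'a set \<Rightarrow> bool" where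
  "power_dominating_set G S \<longleftrightarrow>
     S \<noteq> {} \<and> S \<subseteq> pverts G \<and> (\<exists>t. observed G S t = pverts G)"

definition power_domination_number :: "'a pair_pre_digraph \<Rightarrow> nat" where
  "power_domination_number G = Min (card ` {S. power_dominating_set G S})"

text \<open>
  The propagation time is at least 1 by convention, even for \<open>S = pverts G\<close>. The least element
  exists for every power dominating set: if \<open>observed G S 0 = pverts G\<close>, then also
  \<open>observed G S 1 = pverts G\<close>.
\<close>

definition power_propagation_time :: "'a pair_pre_digraph \<Rightarrow> 'a set \<Rightarrow> enat" where
  "power_propagation_time G S =
     (if power_dominating_set G S then enat (LEAST t. 0 < t \<and> observed G S t = pverts G) else \<infinity>)"

definition product_power_throttling_number :: "'a pair_pre_digraph \<Rightarrow> enat" where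
  "product_power_throttling_number G =
     Min ((\<lambda>S. enat (card S) * power_propagation_time G S) ` {S. S \<noteq> {} \<and> S \<subseteq> pverts G})"

end

theory Submission
  imports Defs "HOL-Library.Disjoint_Sets"
begin

text \<open>
  If \<open>S\<close> needs at least two steps, then \<open>|S| pt(G;S) \<ge> 2 \<gamma>\<^sub>P(G) \<ge> 3n/8\<close>, so everything rests on Reed's
  bound \<open>\<gamma>(G) \<le> 3n/8\<close> for graphs of minimum degree at least 3.

  For the latter, cover the vertices by disjoint paths, as few as possible of order not divisible by
  3 (suitably weighted). Then an end of such a path that has a neighbor outside of the path sees only
  vertices that can be chosen to dominate their own path: exchanging path segments would otherwise
  improve the cover. Hence this end is dominated for free, and a path of order \<open>3k + 1\<close> with such
  an end costs only \<open>k\<close> vertices. Paths whose ends have all their neighbors on the path have chords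
  that also save a vertex; only for closed paths of order 17 and 20 it can be too expensive
  to dominate them in such a way that their neighbors are dominated too. These are balanced against
  the paths of order \<open>1\<close> modulo 3 that depend on them.
\<close>

section \<open>Path covers\<close>

text \<open>The exceptional orders and the weights come from the following counts. A closed member
  of order 3k + 2 that has no dominating set of k + 1 vertices containing its anchors must have an
  anchor, and every anchor is at least 8 positions away from both ends of every Hamiltonian path; so
  the order is at least 8 + 1 + 8 = 17. The fallback of k + 2 vertices satisfies 8(k + 2) \<le> 3(3k
  + 2) only for k \<ge> 10, so with a single dominating set the orders 17, 20, 23, 26 and 29 would
  all need balancing. Instead two sets A and B are built, and 5|A| + 3|B| is bounded by 3n. In
  general only A has to contain anchors, so B gets by with k + 1 vertices, and the fallback in A
  alone is affordable from k = 7 on. This leaves the orders 17 and 20. The weights add up to 8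
  because one of the two sets is used in the end; a member of order 1 that costs nothing in A but
  one vertex in B bounds the weight of B by 3, and the order 23 bounds that of A by 5.\<close>

lemma card_residue_class_mod_3:
  assumes "r < 3"
  shows "card {j. j < N \<and> j mod 3 = r} \<le> (N + 2 - r) div 3"
proof -
  have "{j. j < N \<and> j mod 3 = r} \<subseteq> (\<lambda>i. 3 * i + r) ` {..<(N + 2 - r) div 3}"
  proof
    fix j assume "j \<in> {j. j < N \<and> j mod 3 = r}"
    then have "j < N" "j mod 3 = r" by auto
    then obtain q where q: "j = 3 * q + r" by (metis mult_div_mod_eq)
    with \<open>j < N\<close> assms have "3 * Suc q \<le> N + 2 - r" by arith
    from div_le_mono[OF this, of 3] have "q < (N + 2 - r) div 3" by simp
    with q have "j = 3 * q + r" "q < (N + 2 - r) div 3" by blast+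
    then show "j \<in> (\<lambda>i. 3 * i + r) ` {..<(N + 2 - r) div 3}"
      by blast
  qed
  then have "card {j. j < N \<and> j mod 3 = r} \<le> card {..<(N + 2 - r) div 3}"
    by (meson card_image_le card_mono finite_imageI finite_lessThan le_trans)
  then show ?thesis by simp
qed

definition every_third :: "nat \<Rightarrow> 'a list \<Rightarrow> 'a set" where
  "every_third r xs = (!) xs ` {j. j < length xs \<and> j mod 3 = r}"

lemma every_third_subset: "every_third r xs \<subseteq> set xs"
  by (auto simp: every_third_def)

lemma nth_in_every_third: "j < length xs \<Longrightarrow> j mod 3 = r \<Longrightarrow> xs ! j \<in> every_third r xs"
  by (auto simp: every_third_def)

lemma card_every_third:
  assumes "r < 3"
  shows "card (every_third r xs) \<le> (length xs + 2 - r) div 3"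
  unfolding every_third_def
  by (rule order_trans[OF card_image_le card_residue_class_mod_3[OF assms]]) auto

lemma mod_3_cases [case_names 1 2 3]:
  fixes j :: nat
  obtains "j mod 3 = 0" | "j mod 3 = 1" | "j mod 3 = 2"
proof -
  have "j mod 3 < 3" by simp
  then have "j mod 3 = 0 \<or> j mod 3 = 1 \<or> j mod 3 = 2" by linarith
  then show thesis by (elim disjE) (rule that, assumption)+
qed

section \<open>Hamiltonian paths, their ends, and domination along them\<close>

locale min_degree_3_graph =
  fixes V :: "'a set" and E :: "'a \<Rightarrow> 'a \<Rightarrow> bool"
  assumes finite_V: "finite V"
    and E_sym: "E x y \<Longrightarrow> E y x"
    and E_irrefl: "\<not> E x x"
    and E_in_V: "E x y \<Longrightarrow> x \<in> V"
    and degree_ge_3: "x \<in> V \<Longrightarrow> 3 \<le> card {y. E x y}"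
begin

lemma E_in_V2: "E x y \<Longrightarrow> y \<in> V"
  using E_sym E_in_V by blast

lemma E_commute: "E x y \<longleftrightarrow> E y x"
  using E_sym by blast

text \<open>Members of a cover will be vertex sets instead of paths, so that an argument may pass to
  any other Hamiltonian path of the same member. The empty list is a Hamiltonian path of the empty
  set, which lets an exchange use up a member completely.\<close>

definition ham_path :: "'a set \<Rightarrow> 'a list \<Rightarrow> bool" where
  "ham_path U xs \<longleftrightarrow> distinct xs \<and> set xs = U \<and> successively E xs"

definition dominated_by :: "'a set \<Rightarrow> 'a set" where
  "dominated_by D = D \<union> {v. \<exists>d\<in>D. E d v}"

lemma dominated_by_mono: "D \<subseteq> D' \<Longrightarrow> dominated_by D \<subseteq> dominated_by D'"
  by (auto simp: dominated_by_def)

lemma ham_path_length: "ham_path U xs \<Longrightarrow> length xs = card U"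
  by (auto simp: ham_path_def distinct_card)

lemma ham_path_rev: "ham_path U xs \<Longrightarrow> ham_path U (rev xs)"
  unfolding ham_path_def using E_commute by (simp add: successively_rev)

lemma ham_path_nth_E: "ham_path U xs \<Longrightarrow> Suc i < length xs \<Longrightarrow> E (xs ! i) (xs ! Suc i)"
  by (simp add: ham_path_def successively_conv_nth)

text \<open>Posa rotation: a chord at the start makes the predecessor of its other endpoint a new
  start, while the rest of the path is kept.\<close>

lemma ham_path_rotate:
  assumes "ham_path U (as @ bs)" "as \<noteq> []" "bs \<noteq> []" "E (hd as) (hd bs)"
  shows "ham_path U (rev as @ bs)"
  using assms E_commute unfolding ham_path_def
  by (auto simp: successively_append_iff successively_rev last_rev)

lemma ham_path_join:
  assumes "ham_path U xs" "ham_path U' ys" "U \<inter> U' = {}" "xs \<noteq> []" "ys \<noteq> []" "E (last xs) (hd ys)"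
  shows "ham_path (U \<union> U') (xs @ ys)"
  using assms unfolding ham_path_def by (auto simp: successively_append_iff)

lemma ham_path_split:
  assumes "ham_path U (as @ bs)"
  shows "ham_path (set as) as" "ham_path (set bs) bs"
  using assms unfolding ham_path_def by (auto simp: successively_append_iff)

text \<open>The path may vary with \<open>x\<close>, and by reversal the start stands for either
  end.\<close>

definition open_ends :: "'a set \<Rightarrow> 'a set" where
  "open_ends U = {x. (\<exists>xs. ham_path U (x # xs)) \<and> (\<exists>y. E x y \<and> y \<notin> U)}"

lemma open_endsI: "ham_path U (x # xs) \<Longrightarrow> E x y \<Longrightarrow> y \<notin> U \<Longrightarrow> x \<in> open_ends U"
  unfolding open_ends_def by blast

lemma open_ends_subset: "open_ends U \<subseteq> U"
  by (auto simp: open_ends_def ham_path_def)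

lemma closed_end_neighbors:
  "ham_path U (x # xs) \<Longrightarrow> x \<notin> open_ends U \<Longrightarrow> E x y \<Longrightarrow> y \<in> U"
  by (meson open_endsI)

text \<open>The vertices of \<open>U\<close> whose position modulo 3 is the same in all Hamiltonian paths and equals
  the residue at which a path-cover exchange could not improve the cover: \<open>1\<close> (counting from
  \<open>0\<close>) for order \<open>0\<close> modulo \<open>3\<close>, and \<open>2\<close> otherwise.\<close>

definition anchors :: "'a set \<Rightarrow> 'a set" where
  "anchors U = {y \<in> U. \<forall>as bs. ham_path U (as @ y # bs) \<longrightarrow>
      length as mod 3 = (if card U mod 3 = 0 then 1 else 2)}"

lemma anchors_nth:
  assumes "ham_path U xs" "j < length xs" "xs ! j \<in> anchors U"
  shows "j mod 3 = (if card U mod 3 = 0 then 1 else 2)"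
proof -
  have "ham_path U (take j xs @ xs ! j # drop (Suc j) xs)"
    using assms by (simp add: id_take_nth_drop[symmetric])
  then have "length (take j xs) mod 3 = (if card U mod 3 = 0 then 1 else 2)"
    using assms(3) unfolding anchors_def by blast
  then show ?thesis using assms(2) by simp
qed

lemma anchors_subset: "anchors U \<subseteq> U"
  by (auto simp: anchors_def)

lemma anchors_every_third:
  assumes "ham_path U xs"
  shows "anchors U \<subseteq> every_third (if card U mod 3 = 0 then 1 else 2) xs"
proof
  fix y assume y: "y \<in> anchors U"
  then have "y \<in> set xs" using assms anchors_subset unfolding ham_path_def by blast
  then obtain j where j: "j < length xs" "xs ! j = y" by (auto simp: in_set_conv_nth)
  show "y \<in> every_third (if card U mod 3 = 0 then 1 else 2) xs"
    using nth_in_every_third[OF j(1) anchors_nth[OF assms j(1)]] y j(2) by simp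
qed

text \<open>Position 0 has no predecessor, and a last position 1 modulo 3 has no successor; all
  others are at distance at most 1 from a position 2 modulo 3. So order 1 modulo 3 misses only the
  start, and order 2 modulo 3 misses both ends.\<close>

lemma every_third_2_dominates:
  assumes "ham_path U xs" "0 < j" "j < length xs" "Suc j < length xs \<or> j mod 3 \<noteq> 1"
  shows "xs ! j \<in> dominated_by (every_third 2 xs)"
proof (cases j rule: mod_3_cases)
  case 1
  obtain i where i: "j = Suc i" using assms(2) by (cases j) auto
  have "i mod 3 = 2" using 1 i by (simp add: mod_Suc split: if_splits)
  then have "xs ! i \<in> every_third 2 xs" using assms(3) i nth_in_every_third[of i xs 2] by simp
  moreover have "E (xs ! i) (xs ! j)" using ham_path_nth_E[OF assms(1)] assms(3) i by blast
  ultimately show ?thesis by (auto simp: dominated_by_def)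
next
  case 2
  then have "Suc j mod 3 = 2" "Suc j < length xs" using assms(4) by (simp_all add: mod_Suc)
  then have "xs ! Suc j \<in> every_third 2 xs" using nth_in_every_third by blast
  moreover have "E (xs ! Suc j) (xs ! j)"
    using ham_path_nth_E[OF assms(1) \<open>Suc j < length xs\<close>] by (rule E_sym)
  ultimately show ?thesis by (auto simp: dominated_by_def)
next
  case 3
  then show ?thesis using nth_in_every_third[OF assms(3)] by (auto simp: dominated_by_def)
qed

lemma every_third_1_dominates:
  assumes "ham_path U xs" "length xs mod 3 \<noteq> 1"
  shows "U \<subseteq> dominated_by (every_third 1 xs)"
proof
  fix v assume "v \<in> U"
  then obtain j where j: "j < length xs" "v = xs ! j"
    using assms unfolding ham_path_def by (metis in_set_conv_nth)
  show "v \<in> dominated_by (every_third 1 xs)"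
  proof (cases j rule: mod_3_cases)
    case 1
    then have 2: "Suc j mod 3 = 1" by (simp add: mod_Suc)
    then have 3: "Suc j < length xs" using assms(2) j(1) by (metis Suc_lessI)
    have "xs ! Suc j \<in> every_third 1 xs" using nth_in_every_third[OF 3 2] .
    moreover have "E (xs ! Suc j) v"
      using ham_path_nth_E[OF assms(1) 3] E_sym j(2) by simp
    ultimately show ?thesis by (auto simp: dominated_by_def)
  next
    case 2
    then show ?thesis using j nth_in_every_third[OF j(1)] by (auto simp: dominated_by_def)
  next
    case 3
    then obtain i where i: "j = Suc i" by (cases j) auto
    have "i mod 3 = 1" using 3 i by (simp add: mod_Suc split: if_splits)
    then have "xs ! i \<in> every_third 1 xs" using j i nth_in_every_third[of i xs 1] by simp
    moreover have "E (xs ! i) (xs ! j)"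
      using ham_path_nth_E[OF assms(1)] j(1) i by blast
    ultimately show ?thesis using j by (auto simp: dominated_by_def)
  qed
qed

section \<open>Path covers of minimum cost and exchanges between two members\<close>

definition path_cover :: "'a set set \<Rightarrow> bool" where
  "path_cover C \<longleftrightarrow> partition_on V C \<and> (\<forall>U\<in>C. \<exists>xs. ham_path U xs)"

text \<open>With \<open>s\<^sub>i\<close> paths of order \<open>i\<close> modulo \<open>3\<close>, the multiples of \<open>n = card V\<close> add up to
  \<open>5n(2s\<^sub>1 + s\<^sub>2) + 2n s\<^sub>2\<close>: the cost is a numerical version of minimizing \<open>2s\<^sub>1 + s\<^sub>2\<close>, then \<open>s\<^sub>2\<close>, then
  the total order of the paths of order \<open>0\<close> and finally that of the paths of order \<open>1\<close> modulo \<open>3\<close>.\<close>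

definition order_cost :: "nat \<Rightarrow> nat" where
  "order_cost l = (if l mod 3 = 0 then 2 * l else if l mod 3 = 1 then 10 * card V + l else 7 * card V)"

text \<open>A secondary criterion that prefers few and large closed members of the critical orders 17
  and 20.\<close>

definition closed_cost :: "'a set \<Rightarrow> nat" where
  "closed_cost U = (if open_ends U = {} \<and> card U \<in> {17, 20} then 21 - card U else 0)"

definition optimal_cover :: "'a set set \<Rightarrow> bool" where
  "optimal_cover C \<longleftrightarrow> path_cover C \<and>
     (\<forall>C'. path_cover C' \<longrightarrow> (\<Sum>U\<in>C. order_cost (card U)) \<le> (\<Sum>U\<in>C'. order_cost (card U)) \<and>
       ((\<Sum>U\<in>C. order_cost (card U)) = (\<Sum>U\<in>C'. order_cost (card U)) \<longrightarrow> sum closed_cost C \<le> sum closed_cost C'))"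

lemma optimal_cover_exists: "\<exists>C. optimal_cover C"
proof -
  let ?f = "\<lambda>C. \<Sum>U\<in>C. order_cost (card U)"
  have "path_cover ((\<lambda>v. {v}) ` V)"
    unfolding path_cover_def partition_on_def disjoint_def
    by (auto simp: ham_path_def intro!: exI[of _ "[_]"])
  from ex_has_least_nat[of path_cover, OF this, of ?f]
  obtain C0 where C0: "path_cover C0" "\<forall>C. path_cover C \<longrightarrow> ?f C0 \<le> ?f C" by (elim exE conjE)
  define P where "P C \<longleftrightarrow> path_cover C \<and> ?f C = ?f C0" for C
  have "P C0" using C0 by (simp add: P_def)
  from ex_has_least_nat[of P, OF this, of "sum closed_cost"]
  obtain C where C: "P C" "\<forall>C'. P C' \<longrightarrow> sum closed_cost C \<le> sum closed_cost C'" by (elim exE conjE)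
  have "optimal_cover C"
    unfolding optimal_cover_def
  proof (intro conjI allI impI)
    show "path_cover C" using C(1) by (simp add: P_def)
    fix C' assume C': "path_cover C'"
    show "?f C \<le> ?f C'" using C(1) C0(2) C' by (simp add: P_def)
    assume "?f C = ?f C'"
    then show "sum closed_cost C \<le> sum closed_cost C'" using C C' by (simp add: P_def)
  qed
  then show ?thesis ..
qed

text \<open>One cover has to serve for both cost functions, hence the arbitrary \<open>f\<close>.
  With \<open>f {} = 0\<close> the balance also holds if \<open>U2\<close> is empty and the two
  members merge.\<close>

lemma path_cover_exchange:
  assumes "path_cover C" "U \<in> C" "U' \<in> C" "U \<noteq> U'"
    and "U1 \<union> U2 = U \<union> U'" "U1 \<inter> U2 = {}" "U1 \<noteq> {}"
    and "ham_path U1 xs" "ham_path U2 ys"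
  obtains C' where "path_cover C'"
    "\<And>f :: 'a set \<Rightarrow> nat. f {} = 0 \<Longrightarrow> sum f C' + f U + f U' = sum f C + f U1 + f U2"
proof -
  have part: "partition_on V C" using assms(1) by (simp add: path_cover_def)
  then have fin: "finite C" using finite_V finite_elements by blast
  define R where "R = C - {U, U'}"
  have disjR: "W \<inter> (U \<union> U') = {}" "W \<noteq> {}" if "W \<in> R" for W
    using that part assms(2,3) unfolding R_def partition_on_def disjoint_def by blast+
  have notin: "U1 \<notin> R" "U2 \<notin> R" using disjR assms(5,7) by blast+
  have VR: "\<Union>R \<union> (U \<union> U') = V"
    using part assms(2,3) unfolding R_def partition_on_def by blast
  define C' where "C' = R \<union> ({U1, U2} - {{}})"
  have "path_cover C'"
    unfolding path_cover_def
  proof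
    show "partition_on V C'"
    proof (rule partition_onI)
      show "{} \<notin> C'" using disjR unfolding C'_def by blast
      show "\<Union>C' = V" using VR assms(5) unfolding C'_def by blast
      show "disjnt p q" if "p \<in> C'" "q \<in> C'" "p \<noteq> q" for p q
      proof -
        have "disjnt p q" if "p \<in> R" "q \<in> R" "p \<noteq> q" for p q
          using that part unfolding R_def partition_on_def disjoint_def disjnt_def by blast
        moreover have "disjnt p q \<and> disjnt q p" if "p \<in> R" "q \<in> {U1, U2}" for p q
          using that disjR(1)[of p] assms(5) unfolding disjnt_def by blast
        moreover have "disjnt U1 U2 \<and> disjnt U2 U1" using assms(6) by (auto simp: disjnt_def)
        ultimately show ?thesis using that unfolding C'_def by blast
      qed
    qed
    show "\<forall>W\<in>C'. \<exists>xs. ham_path W xs"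
      using assms unfolding C'_def R_def path_cover_def by blast
  qed
  moreover have "sum f C' + f U + f U' = sum f C + f U1 + f U2" if "f {} = 0" for f :: "'a set \<Rightarrow> nat"
  proof -
    have "sum f C = sum f R + f U + f U'"
    proof -
      have "C = insert U (insert U' R)" "U \<notin> insert U' R" "U' \<notin> R" "finite R"
        using assms fin by (auto simp: R_def)
      then show ?thesis by simp
    qed
    moreover have "sum f C' = sum f R + f U1 + f U2"
    proof (cases "U2 = {}")
      case True
      then have "C' = insert U1 R" using assms(7) by (auto simp: C'_def)
      then show ?thesis using True that notin fin by (simp add: R_def)
    next
      case False
      then have "C' = insert U1 (insert U2 R)" "U1 \<noteq> U2" using assms(6,7) by (auto simp: C'_def)
      then show ?thesis using notin fin by (simp add: R_def)
    qed
    ultimately show ?thesis by simp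
  qed
  ultimately show thesis using that by blast
qed

lemma optimal_cover_exchange:
  assumes "optimal_cover C" "U \<in> C" "U' \<in> C" "U \<noteq> U'"
    and "U1 \<union> U2 = U \<union> U'" "U1 \<inter> U2 = {}" "U1 \<noteq> {}"
    and "ham_path U1 xs" "ham_path U2 ys"
  shows "order_cost (card U) + order_cost (card U') \<le> order_cost (card U1) + order_cost (card U2)"
    and "order_cost (card U) + order_cost (card U') = order_cost (card U1) + order_cost (card U2) \<Longrightarrow>
         closed_cost U + closed_cost U' \<le> closed_cost U1 + closed_cost U2"
proof -
  have C: "path_cover C" using assms(1) by (simp add: optimal_cover_def)
  obtain C' where C': "path_cover C'"
    "\<And>f :: 'a set \<Rightarrow> nat. f {} = 0 \<Longrightarrow> sum f C' + f U + f U' = sum f C + f U1 + f U2"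
    using path_cover_exchange[OF C assms(2-9)] by blast
  have opt: "(\<Sum>U\<in>C. order_cost (card U)) \<le> (\<Sum>U\<in>C'. order_cost (card U))"
    "(\<Sum>U\<in>C. order_cost (card U)) = (\<Sum>U\<in>C'. order_cost (card U)) \<Longrightarrow> sum closed_cost C \<le> sum closed_cost C'"
    using assms(1) C'(1) unfolding optimal_cover_def by blast+
  have 1: "order_cost (card {}) = 0" by (simp add: order_cost_def)
  have 2: "closed_cost {} = 0" by (simp add: closed_cost_def)
  have eq: "(\<Sum>U\<in>C'. order_cost (card U)) + order_cost (card U) + order_cost (card U')
     = (\<Sum>U\<in>C. order_cost (card U)) + order_cost (card U1) + order_cost (card U2)"
    using C'(2)[of "\<lambda>U. order_cost (card U)", OF 1] by blast
  show "order_cost (card U) + order_cost (card U') \<le> order_cost (card U1) + order_cost (card U2)"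
    using eq opt(1) by linarith
  assume "order_cost (card U) + order_cost (card U') = order_cost (card U1) + order_cost (card U2)"
  then have "sum closed_cost C \<le> sum closed_cost C'"
    using eq opt(2) by linarith
  then show "closed_cost U + closed_cost U' \<le> closed_cost U1 + closed_cost U2"
    using C'(2)[of closed_cost, OF 2] by linarith
qed

end

lemma residue_2_split:
  fixes a b :: nat
  assumes "a mod 3 = 2"
  shows "(a + 1 + b) mod 3 = 2 \<longleftrightarrow> b mod 3 = 2"
  using assms by presburger

context min_degree_3_graph
begin

text \<open>Attaching a path that ends next to \<open>y\<close> to either half of a path through \<open>y\<close> must not lower the
  total cost; the possible residues are then forced.\<close>

lemma order_cost_residues:
  assumes "p + i + 1 + j \<le> card V" "p mod 3 \<noteq> 0"
    and "order_cost p + order_cost (i + 1 + j) \<le> order_cost (p + 1 + i) + order_cost j"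
    and "order_cost p + order_cost (i + 1 + j) \<le> order_cost (p + 1 + j) + order_cost i"
  shows "(i + 1 + j) mod 3 \<noteq> 1 \<and> i mod 3 = (if (i + 1 + j) mod 3 = 0 then 1 else 2)"
proof -
  have m: "Suc (x + y) mod 3 = Suc (x mod 3 + y mod 3) mod 3" for x y :: nat
    using mod_Suc_eq[of "x + y" 3] mod_Suc_eq[of "x mod 3 + y mod 3" 3] mod_add_eq[of x 3 y] by simp
  \<comment> \<open>The bound on \<open>p + i + 1 + j\<close> keeps the linear terms too small to
    compensate for a difference in the multiples of \<open>card V\<close>; they decide only when
    these multiples agree.\<close>
  show ?thesis
  proof (cases p rule: mod_3_cases)
    case 1
    then show ?thesis using assms by simp
  next
    case p: 2
    show ?thesis
      by (cases i rule: mod_3_cases; cases j rule: mod_3_cases)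
        (use assms p in \<open>simp_all add: order_cost_def m[of p i] m[of p j] m[of i j]\<close>)
  next
    case p: 3
    show ?thesis
      by (cases i rule: mod_3_cases; cases j rule: mod_3_cases)
        (use assms p in \<open>simp_all add: order_cost_def m[of p i] m[of p j] m[of i j]\<close>)
  qed
qed

section \<open>Hanging a part of one member on an end of another\<close>

lemma ham_path_attach:
  assumes "ham_path U (x # xs)" "U \<inter> U' = {}" "E x y" "ham_path U' (as @ y # bs)"
  shows "ham_path (U \<union> insert y (set bs)) (rev (x # xs) @ y # bs)"
proof -
  have "set (as @ y # bs) = U'" using assms(4) by (simp add: ham_path_def)
  then have "ham_path (set (y # bs)) (y # bs)" "U \<inter> set (y # bs) = {}"
    using ham_path_split(2)[OF assms(4)] assms(2) by auto
  from ham_path_join[OF ham_path_rev[OF assms(1)] this] assms(3) show ?thesis by simp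
qed

lemma path_cover_disjoint:
  "path_cover C \<Longrightarrow> U \<in> C \<Longrightarrow> U' \<in> C \<Longrightarrow> U \<noteq> U' \<Longrightarrow> U \<inter> U' = {}"
  unfolding path_cover_def partition_on_def disjoint_def by blast

lemma path_cover_subset: "path_cover C \<Longrightarrow> U \<in> C \<Longrightarrow> U \<subseteq> V"
  unfolding path_cover_def partition_on_def by blast

text \<open>\<open>U'\<close> is cut just before \<open>y\<close>, and the part from
  \<open>y\<close> on is hung on the end \<open>x\<close> of \<open>U\<close>. Reversing the path of
  \<open>U'\<close> gives the other cut at \<open>y\<close>.\<close>

lemma attach_exchange:
  assumes opt: "optimal_cover C" and C: "U \<in> C" "U' \<in> C" "U \<noteq> U'"
    and x: "ham_path U (x # xs)" "E x y" and y: "ham_path U' (as @ y # bs)"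
  shows "order_cost (card U) + order_cost (length as + 1 + length bs)
      \<le> order_cost (card U + 1 + length bs) + order_cost (length as)"
    and "order_cost (card U) + order_cost (length as + 1 + length bs)
      = order_cost (card U + 1 + length bs) + order_cost (length as) \<Longrightarrow>
      closed_cost U + closed_cost U' \<le> closed_cost (U \<union> insert y (set bs)) + closed_cost (set as)"
    and "card (U \<union> insert y (set bs)) = card U + 1 + length bs"
proof -
  have disj: "U \<inter> U' = {}"
    using opt C path_cover_disjoint unfolding optimal_cover_def by blast
  let ?Q = "U \<union> insert y (set bs)"
  have hp: "ham_path ?Q (rev (x # xs) @ y # bs)" "ham_path (set as) as"
    using ham_path_attach[OF x(1) disj x(2) y] ham_path_split(1)[OF y] by blast+
  have set: "set as \<union> insert y (set bs) = U'" "distinct (as @ y # bs)"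
    using y by (auto simp: ham_path_def)
  then have sets: "?Q \<union> set as = U \<union> U'" "?Q \<inter> set as = {}" "?Q \<noteq> {}" using disj by auto
  have cards: "card U = length (x # xs)" "card U' = length as + 1 + length bs" "card (set as) = length as"
    using ham_path_length[OF x(1)] ham_path_length[OF y] ham_path_length[OF hp(2)] by simp_all
  show Q: "card ?Q = card U + 1 + length bs"
    using ham_path_length[OF hp(1)] cards(1) by simp
  show "order_cost (card U) + order_cost (length as + 1 + length bs)
      \<le> order_cost (card U + 1 + length bs) + order_cost (length as)"
    and "order_cost (card U) + order_cost (length as + 1 + length bs)
      = order_cost (card U + 1 + length bs) + order_cost (length as) \<Longrightarrow>
      closed_cost U + closed_cost U' \<le> closed_cost ?Q + closed_cost (set as)"
    using optimal_cover_exchange[OF opt C sets hp] unfolding Q cards(2,3) by blast+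
qed

lemma ham_path_rev_split: "ham_path U (as @ y # bs) \<Longrightarrow> ham_path U (rev bs @ y # rev as)"
  using ham_path_rev[of U "as @ y # bs"] by simp

lemma open_end_neighbor_anchor:
  assumes opt: "optimal_cover C" and C: "U \<in> C" "U' \<in> C" "U \<noteq> U'"
    and mod: "card U mod 3 \<noteq> 0" and x: "x \<in> open_ends U" "E x y" "y \<in> U'"
  shows "card U' mod 3 \<noteq> 1 \<and> y \<in> anchors U'"
proof -
  obtain xs where xs: "ham_path U (x # xs)" using x(1) unfolding open_ends_def by blast
  have pc: "path_cover C" using opt by (simp add: optimal_cover_def)
  \<comment> \<open>Both cuts at \<open>y\<close> are needed, and for every Hamiltonian path of
    \<open>U'\<close>, since \<open>anchors\<close> quantifies over all of them.\<close>
  have res: "card U' mod 3 \<noteq> 1 \<and> length as mod 3 = (if card U' mod 3 = 0 then 1 else 2)"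
    if y: "ham_path U' (as @ y # bs)" for as bs
  proof -
    have card: "card U' = length as + 1 + length bs" using ham_path_length[OF y] by simp
    have "card U + card U' = card (U \<union> U')"
      using path_cover_disjoint[OF pc C] path_cover_subset[OF pc] C finite_V
      by (metis card_Un_disjoint finite_subset)
    also have "\<dots> \<le> card V"
      using path_cover_subset[OF pc] C finite_V by (intro card_mono) auto
    finally have "card U + length as + 1 + length bs \<le> card V" using card by simp
    then show ?thesis
      using order_cost_residues[of "card U" "length as" "length bs"] mod card
        attach_exchange(1)[OF opt C xs x(2) y]
        attach_exchange(1)[OF opt C xs x(2) ham_path_rev_split[OF y]]
      by (simp add: add.commute add.left_commute)
  qed
  obtain ys where ys: "ham_path U' ys" using pc C(2) unfolding path_cover_def by blast
  then have "y \<in> set ys" using x(3) by (simp add: ham_path_def)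
  then obtain as bs where "ys = as @ y # bs" by (auto simp: in_set_conv_decomp)
  with ys res have "card U' mod 3 \<noteq> 1" by blast
  moreover have "y \<in> anchors U'" unfolding anchors_def using res x(3) by blast
  ultimately show ?thesis ..
qed

text \<open>All orders involved are 2 modulo 3, so the exchange preserves the first cost and the
  second one decides. \<open>U\<close> is open, and so is the part of \<open>U'\<close> left behind,
  next to \<open>y\<close>. Hence the new member must itself be closed, of order 17 or 20, and no
  larger than \<open>U'\<close>. The far end of \<open>U\<close> is an end of the new member for
  both cuts, so its neighbors lie in what the two new members share.\<close>

lemma neighbor_of_closed_order_17_20:
  assumes opt: "optimal_cover C" and C: "U \<in> C" "U' \<in> C" "U \<noteq> U'"
    and mod: "card U mod 3 = 2" and x: "ham_path U (x # xs)" "E x y" "y \<in> U'"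
    and closed: "open_ends U' = {}" "card U' \<in> {17, 20}"
  shows "card U = 8" and "E (last (x # xs)) v \<Longrightarrow> v \<in> insert y U"
proof -
  have pc: "path_cover C" using opt by (simp add: optimal_cover_def)
  have "y \<notin> U" using path_cover_disjoint[OF pc C] x(3) by blast
  then have xU: "x \<in> open_ends U" using open_endsI[OF x(1,2)] by blast
  have anchor: "y \<in> anchors U'"
    using open_end_neighbor_anchor[OF opt C _ xU x(2,3)] mod by simp
  obtain ys where ys: "ham_path U' ys" using pc C(2) unfolding path_cover_def by blast
  then have "y \<in> set ys" using x(3) by (simp add: ham_path_def)
  then obtain as bs where split: "ham_path U' (as @ y # bs)" using ys by (metis in_set_conv_decomp)
  have card: "card U' = length as + 1 + length bs" using ham_path_length[OF split] by simp
  have half: "open_ends (U \<union> insert y (set bs)) = {} \<and> card U + 1 + length bs \<in> {17, 20} \<and>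
      card U + 1 + length bs \<le> card U' \<and> (E (last (x # xs)) v \<longrightarrow> v \<in> U \<union> insert y (set bs))"
    if split: "ham_path U' (as @ y # bs)" for as bs
  proof -
    let ?Q = "U \<union> insert y (set bs)"
    have card: "card U' = length as + 1 + length bs" using ham_path_length[OF split] by simp
    have "length as mod 3 = 2" using anchor split closed(2) unfolding anchors_def by auto
    moreover from this have "length bs mod 3 = 2" using residue_2_split[of "length as" "length bs"] card closed(2) by auto
    ultimately have costs: "order_cost (card U) = 7 * card V" "order_cost (length as) = 7 * card V"
      "order_cost (length as + 1 + length bs) = 7 * card V" "order_cost (card U + 1 + length bs) = 7 * card V"
      using mod residue_2_split[of "length as" "length bs"] residue_2_split[of "card U" "length bs"]
      unfolding order_cost_def by simp_all
    have "as \<noteq> []" using \<open>length as mod 3 = 2\<close> by auto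
    have "ham_path (set as) (rev as)" using ham_path_split(1)[OF split] ham_path_rev by fastforce
    moreover have "E (last as) y" "y \<notin> set as"
      using split \<open>as \<noteq> []\<close> by (auto simp: ham_path_def successively_append_iff)
    ultimately have "last as \<in> open_ends (set as)"
      using \<open>as \<noteq> []\<close> open_endsI[of "set as" "last as" "rev (butlast as)"]
      by (metis append_butlast_last_id rev.simps(2) rev_rev_ident rev_swap)
    then have "closed_cost (set as) = 0" by (auto simp: closed_cost_def)
    moreover have "closed_cost U = 0" using xU by (auto simp: closed_cost_def)
    ultimately have "closed_cost U' \<le> closed_cost ?Q"
      using attach_exchange(2)[OF opt C x(1,2) split] costs by simp
    moreover have "closed_cost U' = 21 - card U'" using closed by (auto simp: closed_cost_def)
    ultimately have Q: "open_ends ?Q = {}" "card ?Q \<in> {17, 20}" "card ?Q \<le> card U'"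
      using closed(2) by (auto simp: closed_cost_def split: if_splits)
    have "ham_path ?Q (rev (x # xs) @ y # bs)"
      using ham_path_attach[OF x(1) path_cover_disjoint[OF pc C] x(2) split] .
    moreover have "rev (x # xs) @ y # bs = last (x # xs) # tl (rev (x # xs)) @ y # bs"
      by (metis append_Cons hd_rev list.collapse list.distinct(1) rev_is_Nil_conv)
    ultimately have "ham_path ?Q (last (x # xs) # tl (rev (x # xs)) @ y # bs)" by (simp only:)
    then have "E (last (x # xs)) v \<longrightarrow> v \<in> ?Q"
      using closed_end_neighbors Q(1) by blast
    then show ?thesis using Q attach_exchange(3)[OF opt C x(1,2) split] by simp
  qed
  have h1: "card U + 1 + length bs \<in> {17, 20}" "card U + 1 + length bs \<le> card U'"
      "E (last (x # xs)) v \<Longrightarrow> v \<in> U \<union> insert y (set bs)"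
    and h2: "card U + 1 + length as \<in> {17, 20}" "card U + 1 + length as \<le> card U'"
      "E (last (x # xs)) v \<Longrightarrow> v \<in> U \<union> insert y (set as)"
    using half[OF split] half[OF ham_path_rev_split[OF split]] by simp_all
  \<comment> \<open>The two new orders add up to \<open>2 * card U + 1 + card U'\<close>. For order
    17 both are 17; for order 20 the sum is odd, so they are 17 and 20.\<close>
  show "card U = 8" using h1(1,2) h2(1,2) card closed(2) by (auto; presburger)
  show "E (last (x # xs)) v \<Longrightarrow> v \<in> insert y U"
    using h1(3) h2(3) split by (auto simp: ham_path_def)
qed

end

section \<open>Paths of order 2 modulo 3\<close>

lemma Suc_add_mod_3: "(a::nat) mod 3 = 2 \<Longrightarrow> b mod 3 = 2 \<Longrightarrow> Suc (a + b) mod 3 = 2"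
  by presburger

lemma mod_3_eq_2_less_8: "(j::nat) mod 3 = 2 \<Longrightarrow> j < 8 \<Longrightarrow> j = 2 \<or> j = 5"
  by presburger

lemma card_insert_le_Suc: "card (insert a A) \<le> Suc (card A)"
  by (cases "finite A") (simp_all add: card_insert_if)

lemma every_third_2_of_5: "every_third 2 [b1, b2, b3, b4, b5] = {b3}"
proof -
  have "{j. j < 5 \<and> j mod 3 = 2} = {2::nat}" by (auto dest: mod_3_eq_2_less_8)
  moreover have "length [b1, b2, b3, b4, b5] = 5" by simp
  ultimately show ?thesis by (simp only: every_third_def) simp
qed

context min_degree_3_graph
begin

section \<open>Chords at the start of a path and dominating sets that contain the anchors\<close>

lemma closed_vertex_neighbors:
  assumes "x \<in> V" "{y. E x y} \<subseteq> {a, b, c}"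
  shows "E x a" "E x b" "E x c"
proof -
  have "card {y. E x y} \<le> card {a, b, c}" using assms(2) by (intro card_mono) auto
  moreover have "card {a, b, c} \<le> 3" by (simp add: card_insert_if)
  ultimately have "card {y. E x y} = card {a, b, c}" using degree_ge_3[OF assms(1)] by linarith
  then have "{y. E x y} = {a, b, c}" using assms(2) by (simp add: card_subset_eq)
  then show "E x a" "E x b" "E x c" by auto
qed

lemma third_neighbor:
  assumes "x \<in> V"
  obtains z where "E x z" "z \<noteq> a" "z \<noteq> b"
proof -
  have "\<not> {y. E x y} \<subseteq> {a, b}"
  proof
    assume "{y. E x y} \<subseteq> {a, b}"
    then have "card {y. E x y} \<le> card {a, b}" by (intro card_mono) auto
    also have "\<dots> \<le> 2" by (simp add: card_insert_if)
    finally show False using degree_ge_3[OF assms] by simp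
  qed
  then show thesis using that by blast
qed

lemma every_third_2_insert_last:
  assumes "ham_path U xs" "card U mod 3 = 2" "xs \<noteq> []"
  shows "U - {hd xs} \<subseteq> dominated_by (insert (last xs) (every_third 2 xs))"
    and "card (insert (last xs) (every_third 2 xs)) \<le> card U div 3 + 1"
    and "insert (last xs) (every_third 2 xs) \<subseteq> U"
    and "anchors U \<subseteq> insert (last xs) (every_third 2 xs)"
proof -
  have len: "length xs = card U" by (rule ham_path_length[OF assms(1)])
  show "U - {hd xs} \<subseteq> dominated_by (insert (last xs) (every_third 2 xs))"
  proof
    fix v assume v: "v \<in> U - {hd xs}"
    then obtain j where j: "j < length xs" "xs ! j = v"
      using assms(1) by (auto simp: ham_path_def in_set_conv_nth)
    have "0 < j" using v j assms(3) by (metis DiffD2 gr0I hd_conv_nth singletonI)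
    show "v \<in> dominated_by (insert (last xs) (every_third 2 xs))"
    proof (cases "Suc j < length xs")
      case True
      then have "v \<in> dominated_by (every_third 2 xs)"
        using every_third_2_dominates[OF assms(1) \<open>0 < j\<close> j(1)] j(2) by simp
      then show ?thesis using dominated_by_mono[OF subset_insertI] by blast
    next
      case False
      then have "v = last xs" using j by (metis Suc_lessI assms(3) diff_Suc_1 last_conv_nth)
      then show ?thesis by (simp add: dominated_by_def)
    qed
  qed
  have "card (every_third 2 xs) \<le> card U div 3" using card_every_third[of 2 xs] len by simp
  then show "card (insert (last xs) (every_third 2 xs)) \<le> card U div 3 + 1"
    using card_insert_le_Suc[of "last xs" "every_third 2 xs"] by linarith
  show "insert (last xs) (every_third 2 xs) \<subseteq> U"
    using every_third_subset[of 2 xs] assms(1,3) by (auto simp: ham_path_def)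
  show "anchors U \<subseteq> insert (last xs) (every_third 2 xs)"
    using anchors_every_third[OF assms(1)] assms(2) by auto
qed

text \<open>The anchors are required because ends of other members rely on them; \<open>R\<close>
  collects the vertices that are dominated from elsewhere. For order 3k + 2 the bound k + 1 in
  \<open>self_dominating\<close> is what the positions 1 modulo 3 need, but these avoid all
  anchors.\<close>

definition anchored_domination :: "nat \<Rightarrow> 'a set \<Rightarrow> 'a set \<Rightarrow> bool" where
  "anchored_domination m U R \<longleftrightarrow>
     (\<exists>D\<subseteq>U. anchors U \<subseteq> D \<and> card D \<le> m \<and> U - R \<subseteq> dominated_by D)"

abbreviation self_dominating :: "'a set \<Rightarrow> bool" where
  "self_dominating U \<equiv> anchored_domination (card U div 3 + 1) U {}"

lemma open_end_anchored_domination: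
  assumes "card U mod 3 = 2" "x \<in> open_ends U"
  shows "anchored_domination (card U div 3 + 1) U (open_ends U)"
proof -
  obtain xs where xs: "ham_path U (x # xs)" using assms(2) unfolding open_ends_def by blast
  show ?thesis
    unfolding anchored_domination_def
    using every_third_2_insert_last[OF xs assms(1)] assms(2)
    by (intro exI[of _ "insert (last (x # xs)) (every_third 2 (x # xs))"]) auto
qed

lemma chord_self_dominating:
  assumes "card U mod 3 = 2" "ham_path U xs" "j < length xs" "j mod 3 = 2" "E (xs ! 0) (xs ! j)"
  shows "self_dominating U"
proof -
  let ?D = "insert (last xs) (every_third 2 xs)"
  have "xs \<noteq> []" using assms(3) by auto
  note D = every_third_2_insert_last[OF assms(2,1) this]
  have "hd xs = xs ! 0" using \<open>xs \<noteq> []\<close> by (simp add: hd_conv_nth)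
  moreover have "xs ! j \<in> every_third 2 xs" using nth_in_every_third[OF assms(3,4)] .
  ultimately have "hd xs \<in> dominated_by ?D" using assms(5) E_sym by (auto simp: dominated_by_def)
  then have "U \<subseteq> dominated_by ?D" using D(1) by blast
  then show ?thesis using D unfolding anchored_domination_def by (intro exI[of _ ?D]) auto
qed

lemma no_anchor_self_dominating:
  assumes "card U mod 3 = 2" "ham_path U xs" "anchors U = {}"
  shows "self_dominating U"
proof -
  have len: "length xs = card U" by (rule ham_path_length[OF assms(2)])
  have "U \<subseteq> dominated_by (every_third 1 xs)" 
    using every_third_1_dominates[OF assms(2)] len assms(1) by simp
  moreover have "card (every_third 1 xs) \<le> card U div 3 + 1" using card_every_third[of 1 xs] len by simp
  moreover have "every_third 1 xs \<subseteq> U" using every_third_subset[of 1 xs] assms(2) by (simp add: ham_path_def)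
  ultimately show ?thesis using assms(3) unfolding anchored_domination_def
    by (intro exI[of _ "every_third 1 xs"]) simp
qed

text \<open>The rotation at the chord moves position \<open>p\<close> to \<open>j - 1 - p\<close>.
  An anchor has residue 2 before and after, and \<open>j = (j - 1 - p) + p + 1\<close>.\<close>

lemma anchor_before_chord:
  assumes "card U mod 3 = 2" "ham_path U xs" "j < length xs" "E (xs ! 0) (xs ! j)" "p < j" "xs ! p \<in> anchors U"
  shows "j mod 3 = 2"
proof -
  have "xs \<noteq> []" using assms(3) by auto
  then have "hd (take j xs) = xs ! 0" "hd (drop j xs) = xs ! j" "take j xs \<noteq> []" "drop j xs \<noteq> []"
    using assms(3,5) by (auto simp: hd_drop_conv_nth hd_conv_nth)
  then have rot: "ham_path U (rev (take j xs) @ drop j xs)"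
    using ham_path_rotate[of U "take j xs" "drop j xs"] assms(2,4) by simp
  have "(rev (take j xs) @ drop j xs) ! (j - 1 - p) = xs ! p"
    using assms(3,5) by (simp add: nth_append rev_nth)
  then have "(j - 1 - p) mod 3 = 2"
    using anchors_nth[OF rot, of "j - 1 - p"] assms by simp
  moreover have "p mod 3 = 2" using anchors_nth[OF assms(2), of p] assms by simp
  moreover have "j = Suc ((j - 1 - p) + p)" using assms(5) by simp
  ultimately show ?thesis using Suc_add_mod_3[of "j - 1 - p" p] by simp
qed

text \<open>A neighbor of the start other than its successor is at position 2 or beyond the anchor
  there. In both cases the chord ends at a residue 2.\<close>

lemma anchor_2_self_dominating:
  assumes "card U mod 3 = 2" "U \<subseteq> V" "ham_path U xs" "2 < length xs" "xs ! 2 \<in> anchors U"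
    and closed: "\<And>v. E (xs ! 0) v \<Longrightarrow> v \<in> U"
  shows "self_dominating U"
proof -
  have "xs ! 0 \<in> V" using assms(2-4) nth_mem[of 0 xs] unfolding ham_path_def
    by (metis less_trans subsetD zero_less_numeral)
  then obtain z where z: "E (xs ! 0) z" "z \<noteq> xs ! 1" by (rule third_neighbor)
  then obtain j where j: "j < length xs" "xs ! j = z"
    using closed assms(3) by (metis ham_path_def in_set_conv_nth)
  have "j \<noteq> 0" "j \<noteq> 1" using z j E_irrefl by metis+
  then have "j = 2 \<or> 2 < j" by linarith
  then have "j mod 3 = 2"
    using anchor_before_chord[OF assms(1,3) j(1), of 2] z(1) j(2) assms(5) by auto
  then show ?thesis using chord_self_dominating[OF assms(1,3) j(1)] z(1) j(2) by simp
qed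

text \<open>Otherwise the start can only have neighbors at positions 1, 3 and 4, and by its degree
  it has all three. The resulting chords give two more Hamiltonian paths with the same tail, to
  which the same applies, so that the vertex at position 4 dominates the first five. The hypothesis
  on closed starts is restricted to paths with this tail because for order 8 only the far end is
  known to stay the same.\<close>

lemma anchor_5_self_dominating:
  assumes card: "card U mod 3 = 2" and U: "U \<subseteq> V" and xs: "ham_path U xs" "5 < length xs"
    and anchor: "xs ! 5 \<in> anchors U"
    and closed: "\<And>ys v. ham_path U ys \<Longrightarrow> drop 5 ys = drop 5 xs \<Longrightarrow> E (ys ! 0) v \<Longrightarrow> v \<in> U"
  shows "self_dominating U"
proof (rule ccontr)
  assume not: "\<not> self_dominating U"
  have start: "E b1 b4" "E b1 b5"
    if b: "ham_path U ([b1, b2, b3, b4, b5] @ drop 5 xs)" for b1 b2 b3 b4 b5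
  proof -
    let ?ys = "[b1, b2, b3, b4, b5] @ drop 5 xs"
    have d5: "drop 5 ?ys = drop 5 xs" by simp
    have "?ys ! 5 = xs ! 5" using xs(2) by (simp add: nth_append)
    have "{v. E b1 v} \<subseteq> {b2, b4, b5}"
    proof
      fix v assume "v \<in> {v. E b1 v}"
      then have v: "E (?ys ! 0) v" by simp
      then have "v \<in> set ?ys" using closed[OF b d5] b by (simp add: ham_path_def)
      then obtain j where j: "j < length ?ys" "?ys ! j = v" by (auto simp only: in_set_conv_nth)
      have "j mod 3 \<noteq> 2" using chord_self_dominating[OF card b j(1)] not v j(2) by blast
      moreover from this have "\<not> 5 < j"
        using anchor_before_chord[OF card b j(1), of 5] v j(2) anchor \<open>?ys ! 5 = xs ! 5\<close> by metis
      moreover have "j \<noteq> 0" using v j(2) E_irrefl by metis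
      ultimately have "j \<in> {1, 3, 4}" by (cases "j = 2"; cases "j = 5") auto
      then show "v \<in> {b2, b4, b5}" using j(2) by auto
    qed
    moreover have "b1 \<in> V" using b U by (auto simp: ham_path_def)
    ultimately show "E b1 b4" "E b1 b5" using closed_vertex_neighbors by blast+
  qed
  obtain a1 a2 a3 a4 a5 where xs5: "xs = [a1, a2, a3, a4, a5] @ drop 5 xs"
  proof -
    have "length (take 5 xs) = Suc (Suc (Suc (Suc (Suc 0))))" using xs(2) by simp
    then obtain a1 a2 a3 a4 a5 where "take 5 xs = [a1, a2, a3, a4, a5]"
      by (auto simp only: length_Suc_conv length_0_conv)
    then show thesis using that append_take_drop_id[of 5 xs] by metis
  qed
  obtain a6 as where d5: "drop 5 xs = a6 # as" using xs(2) by (cases "drop 5 xs") auto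
  have a: "ham_path U ([a1, a2, a3, a4, a5] @ drop 5 xs)" using xs(1) xs5 by simp
  then have path: "distinct (a1 # a2 # a3 # a4 # a5 # a6 # as)" "set (a1 # a2 # a3 # a4 # a5 # a6 # as) = U"
    "E a1 a2" "E a2 a3" "E a3 a4" "E a4 a5" "successively E (a5 # a6 # as)"
    unfolding d5 ham_path_def by auto
  have e1: "E a1 a4" "E a1 a5" using start[OF a] by blast+
  have "ham_path U ([a3, a2, a1, a4, a5] @ drop 5 xs)"
    unfolding d5 ham_path_def using path e1 E_commute by auto
  note e3 = start[OF this]
  have "ham_path U ([a2, a3, a4, a1, a5] @ drop 5 xs)"
    unfolding d5 ham_path_def using path e1 E_commute by auto
  note e2 = start[OF this]
  have x: "xs ! 0 = a1" "xs ! 1 = a2" "xs ! 2 = a3" "xs ! 3 = a4" "xs ! 4 = a5" "drop 3 xs = a4 # a5 # drop 5 xs"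
    by (subst xs5, simp add: nth_append)+
  \<comment> \<open>Dropping three vertices preserves residues: \<open>a5\<close> replaces position
    2 of the usual set, at equal cost.\<close>
  let ?S = "every_third 2 (drop 3 xs)"
  let ?D = "insert a5 (insert (last xs) ?S)"
  have drop3: "ham_path (set (drop 3 xs)) (drop 3 xs)"
    using ham_path_split(2)[of U "take 3 xs" "drop 3 xs"] xs(1) by simp
  have len: "length xs = card U" by (rule ham_path_length[OF xs(1)])
  have "card ?S \<le> (card U - 3) div 3"
    using card_every_third[of 2 "drop 3 xs"] len by simp
  then have "card ?S \<le> card U div 3 - 1" using len xs(2) by linarith
  moreover have "card ?D \<le> card ?S + 2"
    using card_insert_le_Suc[of "last xs" ?S] card_insert_le_Suc[of a5 "insert (last xs) ?S"] by linarith
  moreover have "1 \<le> card U div 3" using len xs(2) by linarith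
  ultimately have "card ?D \<le> card U div 3 + 1" by linarith
  moreover have "?D \<subseteq> U"
  proof -
    have "xs \<noteq> []" using xs(2) by auto
    then have "last xs \<in> U" using xs(1) last_in_set[of xs] by (simp add: ham_path_def)
    moreover have "?S \<subseteq> U"
      using every_third_subset[of 2 "drop 3 xs"] set_drop_subset[of 3 xs] xs(1) by (auto simp: ham_path_def)
    ultimately show ?thesis using path(2) by auto
  qed
  moreover have "anchors U \<subseteq> ?D"
  proof
    fix y assume y: "y \<in> anchors U"
    then obtain j where j: "j < length xs" "xs ! j = y"
      using anchors_subset xs(1) by (metis ham_path_def in_set_conv_nth subsetD)
    have jm: "j mod 3 = 2" using anchors_nth[OF xs(1) j(1)] y j(2) card by simp
    \<comment> \<open>An anchor at position 2 before the chord to position 3 would force 3 to have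
      residue 2.\<close>
    have "j \<noteq> 2"
      using anchor_before_chord[OF card xs(1), of 3 2] xs(2) e1(1) x y j(2) by auto
    then have "3 \<le> j" using jm by (cases "j = 0"; cases "j = 1") auto
    then have "(j - 3) mod 3 = 2" "j - 3 < length (drop 3 xs)" "drop 3 xs ! (j - 3) = y"
      using jm j by (simp_all add: mod_if)
    then show "y \<in> ?D" using nth_in_every_third by blast
  qed
  moreover have "U \<subseteq> dominated_by ?D"
  proof
    fix v assume "v \<in> U"
    then obtain j where j: "j < length xs" "xs ! j = v"
      using xs(1) by (metis ham_path_def in_set_conv_nth)
    consider "j \<le> 4" | "4 < j" "Suc j < length xs" | "Suc j = length xs" using j(1) by linarith
    then show "v \<in> dominated_by ?D"
    proof cases
      case 1
      then have "j \<in> {0, 1, 2, 3, 4}" by auto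
      then have "v = a5 \<or> E v a5" using x j(2) path e1 e2 e3 by auto
      then show ?thesis using E_sym by (auto simp: dominated_by_def)
    next
      case 2
      then have "0 < j - 3" "j - 3 < length (drop 3 xs)" "Suc (j - 3) < length (drop 3 xs)" by auto
      then have "drop 3 xs ! (j - 3) \<in> dominated_by ?S"
        using every_third_2_dominates[OF drop3, of "j - 3"] by blast
      then have "v \<in> dominated_by ?S" using 2 j by simp
      then show ?thesis using dominated_by_mono[of ?S ?D] by blast
    next
      case 3
      then have "v = last xs" using j by (metis diff_Suc_1 last_conv_nth list.size(3) not_less_zero)
      then show ?thesis by (simp add: dominated_by_def)
    qed
  qed
  ultimately have "self_dominating U" unfolding anchored_domination_def by (intro exI[of _ ?D]) simp
  then show False using not by simp
qed

text \<open>Positions 2 and 5 are ruled out by the two preceding lemmas, so 8 is the first one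
  possible; the reversed path gives the same distance from the other end.\<close>

lemma closed_anchors_nth:
  assumes card: "card U mod 3 = 2" and U: "U \<subseteq> V" and xs: "ham_path U xs"
    and closed: "open_ends U = {}" and not: "\<not> self_dominating U"
    and j: "j < length xs" "xs ! j \<in> anchors U"
  shows "8 \<le> j" "j + 9 \<le> length xs" "j mod 3 = 2"
proof -
  have nbrs: "v \<in> U" if "ham_path U ys" "E (ys ! 0) v" for ys v
  proof (cases ys)
    case Nil
    then have "U = {}" using that(1) by (simp add: ham_path_def)
    then show ?thesis using card by simp
  next
    case (Cons y zs)
    then show ?thesis using that closed_end_neighbors[of U y zs v] closed by auto
  qed
  have ge: "8 \<le> j \<and> j mod 3 = 2" if ys: "ham_path U ys" "j < length ys" "ys ! j \<in> anchors U" for ys j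
  proof -
    have m: "j mod 3 = 2" using anchors_nth[OF ys] card by simp
    have "j \<noteq> 2" using anchor_2_self_dominating[OF card U ys(1)] nbrs[OF ys(1)] not ys(2,3) by auto
    moreover have "j \<noteq> 5" using anchor_5_self_dominating[OF card U ys(1)] nbrs not ys(2,3) by auto
    ultimately have "8 \<le> j" using mod_3_eq_2_less_8[OF m] by linarith
    with m show ?thesis by blast
  qed
  show "8 \<le> j" "j mod 3 = 2" using ge[OF xs j] by simp_all
  have "8 \<le> length xs - Suc j"
    using ge[OF ham_path_rev[OF xs], of "length xs - Suc j"] j by (simp add: rev_nth)
  then show "j + 9 \<le> length xs" by linarith
qed

lemma closed_self_dominating:
  assumes "card U mod 3 = 2" "U \<subseteq> V" "ham_path U xs" "open_ends U = {}" "card U < 17"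
  shows "self_dominating U"
proof (rule ccontr)
  assume not: "\<not> self_dominating U"
  then obtain y where "y \<in> anchors U" using no_anchor_self_dominating[OF assms(1,3)] by blast
  then obtain j where "j < length xs" "xs ! j \<in> anchors U"
    using anchors_subset assms(3) by (metis ham_path_def in_set_conv_nth subsetD)
  then show False using closed_anchors_nth[OF assms(1-4) not, of j] assms(5) ham_path_length[OF assms(3)] by simp
qed

text \<open>The positions 2 modulo 3 with 8 vertices on either side are 8 for order 17, and 8 and 11
  for order 20.\<close>

lemma card_closed_anchors:
  assumes "U \<subseteq> V" "ham_path U xs" "open_ends U = {}" "\<not> self_dominating U"
  shows "card U = 17 \<Longrightarrow> \<exists>y. anchors U \<subseteq> {y}" "card U = 20 \<Longrightarrow> \<exists>y z. anchors U \<subseteq> {y, z}"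
proof -
  have sub: "\<exists>j. y = xs ! j \<and> 8 \<le> j \<and> j + 9 \<le> card U \<and> j mod 3 = 2"
    if m: "card U mod 3 = 2" and y: "y \<in> anchors U" for y
  proof -
    obtain j where "j < length xs" "xs ! j = y"
      using anchors_subset assms(2) y by (metis ham_path_def in_set_conv_nth subsetD)
    then show ?thesis
      using closed_anchors_nth[OF m assms, of j] y ham_path_length[OF assms(2)] by auto
  qed
  show "\<exists>y. anchors U \<subseteq> {y}" if "card U = 17"
  proof -
    have "y = xs ! 8" if y: "y \<in> anchors U" for y
    proof -
      obtain j where "y = xs ! j" "8 \<le> j" "j + 9 \<le> 17" using sub[OF _ y] \<open>card U = 17\<close> by auto
      then show ?thesis by (simp add: le_antisym)
    qed
    then show ?thesis by blast
  qed
  show "\<exists>y z. anchors U \<subseteq> {y, z}" if "card U = 20"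
  proof -
    have "y \<in> {xs ! 8, xs ! 11}" if y: "y \<in> anchors U" for y
    proof -
      obtain j where j: "y = xs ! j" "8 \<le> j" "j + 9 \<le> 20" "j mod 3 = 2"
        using sub[OF _ y] \<open>card U = 20\<close> by auto
      then have "j = 8 \<or> j = 9 \<or> j = 10 \<or> j = 11" by linarith
      then show ?thesis using j(1,4) by auto
    qed
    then show ?thesis by blast
  qed
qed

text \<open>The hypothesis on \<open>y\<close> is what optimality provides when \<open>y\<close> lies in a closed member of
  order 17 or 20 (lemma \<open>neighbor_of_closed_order_17_20\<close>).\<close>

lemma order_8_self_dominating:
  assumes card: "card U = 8" and U: "U \<subseteq> V" and y: "y \<notin> U"
    and xs: "ham_path U xs" "E (last xs) y"
    and nbrs: "\<And>zs v. ham_path U zs \<Longrightarrow> E (last zs) y \<Longrightarrow> E (hd zs) v \<Longrightarrow> v \<in> insert y U"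
  shows "self_dominating U"
proof (rule ccontr)
  assume not: "\<not> self_dominating U"
  have m: "card U mod 3 = 2" using card by simp
  have index: "j = 2 \<or> j = 5" if "ham_path U ys" "j < length ys" "ys ! j \<in> anchors U" for ys j
  proof -
    have "j mod 3 = 2" using anchors_nth[OF that] m by simp
    moreover have "j < 8" using that(2) ham_path_length[OF that(1)] card by simp
    ultimately show ?thesis by (rule mod_3_eq_2_less_8)
  qed
  have anchor: "\<exists>j<length ys. ys ! j \<in> anchors U" if ys: "ham_path U ys" for ys
  proof -
    obtain a where "a \<in> anchors U" using no_anchor_self_dominating[OF m ys] not by blast
    then show ?thesis using anchors_subset ys by (metis ham_path_def in_set_conv_nth subsetD)
  qed
  have len: "length ys = 8" if "ham_path U ys" for ys using ham_path_length[OF that] card by simp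
  have hd0: "hd ys = ys ! 0" if "ham_path U ys" for ys
    using len[OF that] by (cases ys) auto
  \<comment> \<open>Anchors can only be at positions 2 and 5. If both ends of some path see
    \<open>y\<close>, then \<open>nbrs\<close> controls both ends, and a third neighbor of the start
    excludes position 2; by reversal, position 5 as well. Otherwise all paths that end like
    \<open>xs\<close> have a closed start, and the lemmas on anchors at positions 2 and 5
    apply.\<close>
  show False
  proof (cases "\<exists>zs. ham_path U zs \<and> E (hd zs) y \<and> E (last zs) y")
    case True
    have second: "ys ! 2 \<notin> anchors U" if ys: "ham_path U ys" "E (hd ys) y" "E (last ys) y" for ys
    proof
      assume a: "ys ! 2 \<in> anchors U"
      have "hd ys \<in> V" using ys(2) E_in_V by blast
      then obtain v where v: "E (hd ys) v" "v \<noteq> y" "v \<noteq> ys ! 1" by (rule third_neighbor)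
      then have "v \<in> set ys" using nbrs[OF ys(1,3) v(1)] ys(1) by (auto simp: ham_path_def)
      then obtain j where j: "j < length ys" "ys ! j = v" by (auto simp: in_set_conv_nth)
      have "j \<noteq> 0" "j \<noteq> 1" using v j(2) hd0[OF ys(1)] E_irrefl by metis+
      then have "j = 2 \<or> 2 < j" by linarith
      then have "j mod 3 = 2"
        using anchor_before_chord[OF m ys(1) j(1), of 2] v(1) j(2) a hd0[OF ys(1)] by auto
      then show False using chord_self_dominating[OF m ys(1) j(1)] v(1) j(2) not hd0[OF ys(1)] by simp
    qed
    from True obtain zs where zs: "ham_path U zs" "E (hd zs) y" "E (last zs) y" by blast
    from anchor[OF zs(1)] obtain j where j: "j < length zs" "zs ! j \<in> anchors U" by blast
    have "rev zs ! 2 = zs ! 5" using len[OF zs(1)] by (simp add: rev_nth)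
    then show False
      using index[OF zs(1) j] j(2) second[OF zs] second[OF ham_path_rev[OF zs(1)]] zs(2,3)
      by (auto simp: hd_rev last_rev)
  next
    case False
    have closed: "v \<in> U" if ys: "ham_path U ys" "last ys = last xs" "E (ys ! 0) v" for ys v
    proof -
      have "E (last ys) y" using xs(2) ys(2) by simp
      then have "v \<in> insert y U" using nbrs[OF ys(1)] ys(3) hd0[OF ys(1)] by simp
      moreover have "\<not> E (hd ys) y" using False ys(1) \<open>E (last ys) y\<close> by blast
      ultimately show ?thesis using ys(3) hd0[OF ys(1)] by auto
    qed
    from anchor[OF xs(1)] obtain j where j: "j < length xs" "xs ! j \<in> anchors U" by blast
    have last: "last ys = last xs" if "ham_path U ys" "drop 5 ys = drop 5 xs" for ys
      using last_drop[of 5 ys] last_drop[of 5 xs] that(2) len[OF that(1)] len[OF xs(1)] by simp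
    have "\<not> xs ! 5 \<in> anchors U"
      using anchor_5_self_dominating[OF m U xs(1)] not len[OF xs(1)] closed last by auto
    moreover have "\<not> xs ! 2 \<in> anchors U"
      using anchor_2_self_dominating[OF m U xs(1)] not len[OF xs(1)] closed[OF xs(1)] by auto
    moreover note index[OF xs(1) j] j(2)
    ultimately show False by auto
  qed
qed

text \<open>Two vertices would be too many in the weighted count: 5 * 2 + 3 * 2 > 15. The middle
  vertex works unless some closed end is not adjacent to it; then the degree condition yields
  chords, the rotated paths leave no anchors, and some other vertex works.\<close>

lemma order_5_anchored_domination:
  assumes card: "card U = 5" and U: "U \<subseteq> V" and xs: "ham_path U xs"
  shows "anchored_domination 1 U (open_ends U)"
proof -
  have anchor: "anchors U \<subseteq> {b3}" if "ham_path U [b1, b2, b3, b4, b5]" for b1 b2 b3 b4 b5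
    using anchors_every_third[OF that] card by (auto simp: every_third_2_of_5)
  have end5: "b1 \<in> open_ends U \<or> E b1 b3 \<or> E b1 b4 \<and> E b1 b5"
    if b: "ham_path U [b1, b2, b3, b4, b5]" for b1 b2 b3 b4 b5
  proof (rule ccontr)
    assume n: "\<not> (b1 \<in> open_ends U \<or> E b1 b3 \<or> E b1 b4 \<and> E b1 b5)"
    have "{v. E b1 v} \<subseteq> {b2, b4, b5}"
      using closed_end_neighbors[OF b] n b E_irrefl by (auto simp: ham_path_def)
    moreover have "b1 \<in> V" using b U by (auto simp: ham_path_def)
    ultimately show False using closed_vertex_neighbors n by blast
  qed
  have one: "anchored_domination 1 U (open_ends U)"
    if "d \<in> U" "anchors U \<subseteq> {d}" "\<And>v. v \<in> U \<Longrightarrow> v \<notin> open_ends U \<Longrightarrow> v \<noteq> d \<Longrightarrow> E v d" for d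
    unfolding anchored_domination_def dominated_by_def
    using that E_sym by (intro exI[of _ "{d}"]) auto
  have *: "anchored_domination 1 U (open_ends U)"
    if a: "ham_path U [a1, a2, a3, a4, a5]" and a1: "a1 \<notin> open_ends U" "\<not> E a1 a3" for a1 a2 a3 a4 a5
  proof -
    have path: "distinct [a1, a2, a3, a4, a5]" "U = {a1, a2, a3, a4, a5}" "E a1 a2" "E a2 a3" "E a3 a4" "E a4 a5"
      using a by (auto simp: ham_path_def)
    have e1: "E a1 a4" "E a1 a5" using end5[OF a] a1 by blast+
    have p3: "ham_path U [a3, a2, a1, a4, a5]" and p2: "ham_path U [a2, a3, a4, a1, a5]"
      using path e1 E_commute by (auto simp: ham_path_def)
    \<comment> \<open>Anchors lie in the middle of every Hamiltonian path, but these two paths have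
      different middle vertices.\<close>
    have no: "anchors U = {}" using anchor[OF a] anchor[OF p3] path(1) by auto
    show ?thesis
    proof (cases "a3 \<in> open_ends U")
      case True
      then show ?thesis using one[of a1] no path e1 E_commute by auto
    next
      case False
      have "\<not> E a3 a1" using a1(2) E_sym by blast
      then have e3: "E a3 a4" "E a3 a5" using end5[OF p3] False by blast+
      show ?thesis
      proof (cases "a2 \<in> open_ends U \<or> E a2 a4")
        case True
        then show ?thesis using one[of a4] no path e1 e3 E_commute by auto
      next
        case False
        then have "E a2 a5" using end5[OF p2] by blast
        then show ?thesis using one[of a5] no path e1 e3 E_commute by auto
      qed
    qed
  qed
  have "length xs = Suc (Suc (Suc (Suc (Suc 0))))" using ham_path_length[OF xs] card by simp
  then obtain a1 a2 a3 a4 a5 where "xs = [a1, a2, a3, a4, a5]"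
    by (auto simp only: length_Suc_conv length_0_conv)
  then have a: "ham_path U [a1, a2, a3, a4, a5]" using xs by simp
  then have r: "ham_path U [a5, a4, a3, a2, a1]" using ham_path_rev by fastforce
  show ?thesis
  proof (cases "(a1 \<in> open_ends U \<or> E a1 a3) \<and> (a5 \<in> open_ends U \<or> E a5 a3)")
    case True
    then show ?thesis using one[of a3] anchor[OF a] a E_commute by (auto simp: ham_path_def)
  next
    case False
    then show ?thesis using *[OF a] *[OF r] by blast
  qed
qed

end

section \<open>Closed paths of order 1 modulo 3\<close>

text \<open>A refutation of the existence of a graph on \<open>{0..<N}\<close> without dominating set of size
  \<open>N div 3\<close> and such that for every Hamiltonian path the start has at least three neighbors, and all
  of them have a position (counted from \<open>0\<close>) that is below \<open>i\<close> and not \<open>2\<close> modulo \<open>3\<close>. A branch is a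
  list of edges known to exist. It is closed by a dominating set, or it is split on a further neighbor
  of the common start of some Hamiltonian paths.\<close>

datatype refutation_step = Dominate "nat list" | Split "nat list list"

definition joined :: "(nat \<times> nat) list \<Rightarrow> nat \<Rightarrow> nat \<Rightarrow> bool" where
  "joined es a b \<longleftrightarrow> (a, b) \<in> set es \<or> (b, a) \<in> set es"

definition dominating_list :: "nat \<Rightarrow> (nat \<times> nat) list \<Rightarrow> nat list \<Rightarrow> bool" where
  "dominating_list N es ds \<longleftrightarrow> length ds \<le> N div 3 \<and> (\<forall>d\<in>set ds. d < N) \<and>
     (\<forall>v\<in>set [0..<N]. \<exists>d\<in>set ds. d = v \<or> joined es d v)"

definition ham_list :: "nat \<Rightarrow> (nat \<times> nat) list \<Rightarrow> nat list \<Rightarrow> bool" where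
  "ham_list N es p \<longleftrightarrow> length p = N \<and> distinct p \<and> (\<forall>v\<in>set p. v < N) \<and> successively (joined es) p"

definition excluded :: "nat \<Rightarrow> nat \<Rightarrow> nat list list \<Rightarrow> nat \<Rightarrow> bool" where
  "excluded N i ps w \<longleftrightarrow> (\<exists>p\<in>set ps. \<exists>j\<in>set [0..<N]. p ! j = w \<and> (j mod 3 = 2 \<or> i \<le> j))"

text \<open>The open branches form a stack. A \<open>Split\<close> closes its branch if a known
  neighbor of the start is excluded by one of the paths. Otherwise at most two neighbors are known,
  so a further one exists, and there is a new branch for each candidate.\<close>

fun refutes :: "nat \<Rightarrow> nat \<Rightarrow> (nat \<times> nat) list list \<Rightarrow> refutation_step list \<Rightarrow> bool" where
  "refutes N i [] c \<longleftrightarrow> True"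
| "refutes N i (es # obl) [] \<longleftrightarrow> False"
| "refutes N i (es # obl) (Dominate ds # c) \<longleftrightarrow> dominating_list N es ds \<and> refutes N i obl c"
| "refutes N i (es # obl) (Split ps # c) \<longleftrightarrow>
     (let s = hd (hd ps); known = filter (joined es s) [0..<N] in
      ps \<noteq> [] \<and> s < N \<and> (\<forall>p\<in>set ps. hd p = s \<and> ham_list N es p) \<and>
      (if list_ex (excluded N i ps) known then refutes N i obl c
       else length known \<le> 2 \<and>
         refutes N i (map (\<lambda>w. (s, w) # es)
            (filter (\<lambda>w. w \<noteq> s \<and> \<not> joined es s w \<and> \<not> excluded N i ps w) [0..<N]) @ obl) c))"

text \<open>Invariant: some branch on the stack consists of edges of \<open>e\<close> only. Steps on
  other branches do not touch it, and a \<open>Split\<close> of it leaves a successor with one more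
  edge of \<open>e\<close>. The certificate cannot end before such a branch is closed, and only
  \<open>Dominate\<close> can close it.\<close>

lemma refutes_sound:
  fixes e :: "nat \<Rightarrow> nat \<Rightarrow> bool"
  assumes sym: "\<And>a b. e a b \<Longrightarrow> e b a" and irrefl: "\<And>a. \<not> e a a"
    and path: "\<And>p j. distinct p \<Longrightarrow> set p = {..<N} \<Longrightarrow> successively e p \<Longrightarrow> j < N \<Longrightarrow> e (hd p) (p ! j) \<Longrightarrow>
        j mod 3 \<noteq> 2 \<and> j < i"
    and deg: "\<And>p. distinct p \<Longrightarrow> set p = {..<N} \<Longrightarrow> successively e p \<Longrightarrow> 3 \<le> card {w. w < N \<and> e (hd p) w}"
    and "refutes N i obl c" "es \<in> set obl" "\<And>a b. (a, b) \<in> set es \<Longrightarrow> e a b"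
  shows "\<exists>D\<subseteq>{..<N}. card D \<le> N div 3 \<and> (\<forall>v<N. \<exists>d\<in>D. d = v \<or> e d v)"
  using assms(5-7)
proof (induction c arbitrary: obl es)
  case Nil
  then show ?case by (cases obl) auto
next
  case (Cons step c)
  obtain es1 obl1 where obl: "obl = es1 # obl1" using Cons.prems(2) by (cases obl) auto
  show ?case
  proof (cases "es = es1")
    case False
    then have mem: "es \<in> set obl1" using Cons.prems(2) obl by simp
    show ?thesis
    proof (cases step)
      case (Dominate ds)
      then show ?thesis using Cons.IH[of obl1 es] Cons.prems(1,3) obl mem by simp
    next
      case (Split ps)
      define s where "s = hd (hd ps)"
      define known where "known = filter (joined es1 s) [0..<N]"
      define new where "new = filter (\<lambda>w. w \<noteq> s \<and> \<not> joined es1 s w \<and> \<not> excluded N i ps w) [0..<N]"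
      have rest: "if list_ex (excluded N i ps) known then refutes N i obl1 c
          else length known \<le> 2 \<and> refutes N i (map (\<lambda>w. (s, w) # es1) new @ obl1) c"
        using Cons.prems(1)
        unfolding obl Split refutes.simps Let_def s_def known_def new_def by (elim conjE)
      show ?thesis
      proof (cases "list_ex (excluded N i ps) known")
        case True
        then have "refutes N i obl1 c" using rest by simp
        then show ?thesis using mem Cons.prems(3) by (rule Cons.IH)
      next
        case False
        then have ref: "refutes N i (map (\<lambda>w. (s, w) # es1) new @ obl1) c" using rest by simp
        have "es \<in> set (map (\<lambda>w. (s, w) # es1) new @ obl1)" using mem by simp
        from Cons.IH[OF ref this Cons.prems(3)] show ?thesis .
      qed
    qed
  next
    case True
    have joined: "e a b" if "joined es a b" for a b
      using that Cons.prems(3) sym unfolding joined_def by blast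
    show ?thesis
    proof (cases step)
      case (Dominate ds)
      then have ds: "length ds \<le> N div 3" "set ds \<subseteq> {..<N}" "\<forall>v<N. \<exists>d\<in>set ds. d = v \<or> joined es d v"
        using Cons.prems(1) True unfolding obl by (auto simp: dominating_list_def)
      have "card (set ds) \<le> N div 3" using ds(1) card_length[of ds] by linarith
      moreover have "\<forall>v<N. \<exists>d\<in>set ds. d = v \<or> e d v" using ds(3) joined by blast
      ultimately show ?thesis using ds(2) by blast
    next
      case (Split ps)
      define s where "s = hd (hd ps)"
      define known where "known = filter (joined es s) [0..<N]"
      define new where "new = filter (\<lambda>w. w \<noteq> s \<and> \<not> joined es s w \<and> \<not> excluded N i ps w) [0..<N]"
      have ps: "ps \<noteq> []" "s < N" "\<And>p. p \<in> set ps \<Longrightarrow> hd p = s \<and> ham_list N es p"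
        and rest: "if list_ex (excluded N i ps) known then refutes N i obl1 c
          else length known \<le> 2 \<and> refutes N i (map (\<lambda>w. (s, w) # es) new @ obl1) c"
        using Cons.prems(1) unfolding obl Split refutes.simps Let_def s_def known_def new_def True
        by (elim conjE; blast)+
      have ham: "distinct p \<and> set p = {..<N} \<and> successively e p \<and> hd p = s" if "p \<in> set ps" for p
      proof -
        have p: "length p = N" "distinct p" "set p \<subseteq> {..<N}" "successively (joined es) p"
          using ps(3)[OF that] unfolding ham_list_def by auto
        have "card (set p) = N" using p(1,2) by (simp add: distinct_card)
        then have "set p = {..<N}" using p(3) by (intro card_subset_eq) auto
        moreover have "successively e p" using p(4) joined by (rule successively_mono)
        ultimately show ?thesis using p(2) ps(3)[OF that] by blast
      qed
      have not_excl: "\<not> excluded N i ps w" if "e s w" for w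
      proof
        assume "excluded N i ps w"
        then obtain p j where p: "p \<in> set ps" "j < N" "p ! j = w" "j mod 3 = 2 \<or> i \<le> j"
          unfolding excluded_def by auto
        then show False using path[of p j] ham[OF p(1)] that by auto
      qed
      then have "\<not> list_ex (excluded N i ps) known"
        using joined by (auto simp: list_ex_iff known_def)
      then have known: "length known \<le> 2"
        and ref: "refutes N i (map (\<lambda>w. (s, w) # es) new @ obl1) c" using rest by (simp_all del: refutes.simps)
      obtain p where "p \<in> set ps" using ps(1) by (cases ps) auto
      then have "3 \<le> card {w. w < N \<and> e s w}" using deg[of p] ham by metis
      moreover have "card (set known) \<le> 2" using known card_length[of known] by linarith
      ultimately have "\<not> {w. w < N \<and> e s w} \<subseteq> set known"
        using card_mono[of "set known" "{w. w < N \<and> e s w}"] by auto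
      then obtain w where w: "w < N" "e s w" "w \<notin> set known" by blast
      then have "w \<in> set new"
        using not_excl[OF w(2)] irrefl by (auto simp: new_def known_def)
      then show ?thesis
        using Cons.IH[OF ref, of "(s, w) # es"] Cons.prems(3) w(2) by fastforce
    qed
  qed
qed

section \<open>Certificates for the orders 4, 7, 10 and 13\<close>

definition path_edges :: "nat \<Rightarrow> (nat \<times> nat) list" where
  "path_edges N = map (\<lambda>j. (j, Suc j)) [0..<N - 1]"

declare refutes.simps [simp del]

text \<open>In each of these lemmas, the first number is the order \<open>N\<close> of the path 0,
  ..., N - 1 and the second one is \<open>i\<close>; the edge \<open>(0, i - 1)\<close> is the
  longest chord that the start of any Hamiltonian path may have. The cases with \<open>i - 1\<close>
  of residue 2 do not arise.\<close>

lemma refutes_7_5: "refutes 7 5 [(0, 4) # path_edges 7]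
     [Split [[6,5,4,0,1,2,3],[6,5,4,3,2,1,0]]]"
  by code_simp

lemma refutes_7_7: "refutes 7 7 [(0, 6) # path_edges 7]
     [Split [[0,1,2,3,4,5,6]], Split [[5,4,3,2,1,0,6]], Dominate [3,5], Dominate [0,5],
     Split [[2,1,0,6,5,4,3]], Dominate [0,2], Dominate [4,2]]"
  by code_simp

lemma refutes_10_5: "refutes 10 5 [(0, 4) # path_edges 10]
     [Split [[0,1,2,3,4,5,6,7,8,9]], Split [[1,2,3,0,4,5,6,7,8,9]],
     Split [[2,1,0,3,4,5,6,7,8,9]], Dominate [4,5,8]]"
  by code_simp

lemma refutes_10_7: "refutes 10 7 [(0, 6) # path_edges 10]
     [Split [[9,8,7,6,0,1,2,3,4,5],[9,8,7,6,5,4,3,2,1,0]],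
     Split [[7,8,9,6,0,1,2,3,4,5],[7,8,9,6,5,4,3,2,1,0]]]"
  by code_simp

lemma refutes_10_8: "refutes 10 8 [(0, 7) # path_edges 10]
     [Split [[9,8,7,0,1,2,3,4,5,6],[9,8,7,6,5,4,3,2,1,0]],
     Split [[8,9,3,2,1,0,7,6,5,4],[8,9,3,4,5,6,7,0,1,2]]]"
  by code_simp

lemma refutes_10_10: "refutes 10 10 [(0, 9) # path_edges 10]
     [Split [[0,1,2,3,4,5,6,7,8,9]], Split [[1,0,9,8,7,6,5,4,3,2],[1,2,3,0,9,8,7,6,5,4]],
     Split [[2,1,0,3,4,5,6,7,8,9],[2,1,4,3,0,9,8,7,6,5],[2,1,0,9,8,7,6,5,4,3]],
     Split [[5,4,3,2,1,0,9,8,7,6]], Dominate [3,5,8], Dominate [0,5,7], Dominate [0,1,5],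
     Dominate [3,7,5], Split [[2,1,0,9,8,7,6,5,4,3]], Dominate [0,2,7], Dominate [4,2,8],
     Dominate [0,2,6], Dominate [4,2,7], Split [[8,7,6,5,4,3,2,1,0,9]], Dominate [6,8,3],
     Dominate [0,8,4], Dominate [6,2,8], Dominate [0,3,8],
     Split [[8,7,6,5,4,3,2,1,0,9],[8,9,0,7,6,5,4,3,2,1]],
     Split [[9,0,1,2,3,4,5,6,7,8],[9,0,1,8,7,6,5,4,3,2],[9,0,7,8,1,2,3,4,5,6]],
     Split [[2,1,0,9,8,7,6,5,4,3]], Dominate [0,5,4], Dominate [0,2,4], Dominate [0,2,5],
     Dominate [7,2,4]]"
  by code_simp

lemma refutes_13_5: "refutes 13 5 [(0, 4) # path_edges 13]
     [Split [[0,1,2,3,4,5,6,7,8,9,10,11,12]], Split [[1,2,3,0,4,5,6,7,8,9,10,11,12]],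
     Split [[2,1,0,3,4,5,6,7,8,9,10,11,12]], Dominate [4,5,8,11]]"
  by code_simp

lemma refutes_13_7: "refutes 13 7 [(0, 6) # path_edges 13]
     [Split [[0,1,2,3,4,5,6,7,8,9,10,11,12]], Split [[5,4,3,2,1,0,6,7,8,9,10,11,12]],
     Dominate [3,5,8,11], Dominate [0,5,8,11], Split [[5,4,3,2,1,0,6,7,8,9,10,11,12]],
     Split [[2,3,4,0,1,5,6,7,8,9,10,11,12],[2,3,4,5,1,0,6,7,8,9,10,11,12]],
     Dominate [4,2,8,11], Dominate [0,2,8,11]]"
  by code_simp

lemma refutes_13_8: "refutes 13 8 [(0, 7) # path_edges 13]
     [Split [[12,11,10,9,8,7,0,1,2,3,4,5,6],[12,11,10,9,8,7,6,5,4,3,2,1,0]],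
     Split [[9,10,11,12,8,7,0,1,2,3,4,5,6],[9,10,11,12,8,7,6,5,4,3,2,1,0]],
     Split [[10,11,12,9,8,7,0,1,2,3,4,5,6],[10,11,12,9,8,7,6,5,4,3,2,1,0]],
     Split [[11,10,9,12,8,7,0,1,2,3,4,5,6],[11,10,9,12,8,7,6,5,4,3,2,1,0]], Dominate [0,2,5,8],
     Split [[10,11,12,9,8,7,0,1,2,3,4,5,6],[10,11,12,9,8,7,6,5,4,3,2,1,0]],
     Split [[11,12,9,10,8,7,0,1,2,3,4,5,6],[11,12,9,10,8,7,6,5,4,3,2,1,0]],
     Split [[12,9,10,11,8,7,0,1,2,3,4,5,6],[12,9,10,11,8,7,6,5,4,3,2,1,0]], Dominate [0,2,5,8]]"
  by code_simp

lemma refutes_13_10: "refutes 13 10 [(0, 9) # path_edges 13]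
     [Split [[12,11,10,9,0,1,2,3,4,5,6,7,8],[12,11,10,9,8,7,6,5,4,3,2,1,0]],
     Split [[0,1,2,3,4,5,6,7,8,9,10,11,12],[0,1,2,3,12,11,10,9,8,7,6,5,4]],
     Split [[2,1,0,3,4,5,6,7,8,9,10,11,12],[2,1,0,9,10,11,12,3,4,5,6,7,8]],
     Split [[4,5,6,7,8,9,0,1,2,3,12,11,10],[4,5,6,7,8,9,10,11,12,3,0,1,2]],
     Split [[6,5,4,7,8,9,0,1,2,3,12,11,10],[6,5,4,7,8,9,10,11,12,3,0,1,2]],
     Split [[8,7,4,5,6,3,0,1,2,9,10,11,12],[8,7,6,5,4,3,12,11,10,9,0,1,2]],
     Dominate [0,3,8,10], Dominate [0,3,6,10],
     Split [[10,11,12,3,0,1,2,9,8,4,5,6,7],[10,11,12,3,4,5,6,7,8,9,0,1,2],[10,11,12,3,0,1,2,9,8,7,6,5,4]],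
     Split [[5,6,7,8,4,3,0,1,2,9,10,11,12],[5,6,7,8,4,3,12,11,10,9,0,1,2]],
     Split [[6,7,8,5,4,3,0,1,2,9,10,11,12],[6,7,8,5,4,3,12,11,10,9,0,1,2]],
     Dominate [0,9,6,11], Dominate [0,9,8,11],
     Split [[6,7,8,4,5,9,0,1,2,3,10,11,12],[6,7,8,4,5,9,10,11,12,3,0,1,2]],
     Dominate [1,6,8,11], Dominate [0,9,6,11],
     Split [[2,1,0,7,6,5,4,3,12,11,10,9,8],[2,1,0,9,10,11,12,3,4,5,6,7,8]],
     Split [[0,1,2,3,4,5,6,7,8,9,10,11,12],[0,1,2,3,4,5,12,11,10,9,8,7,6]],
     Split [[2,1,0,3,4,5,6,7,8,9,10,11,12],[2,1,0,3,4,5,12,11,10,9,8,7,6]],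
     Dominate [0,4,7,11],
     Split [[4,3,0,1,2,9,8,7,6,5,12,11,10],[4,3,2,1,0,9,10,11,12,5,6,7,8]],
     Dominate [9,4,6,11],
     Split [[6,7,8,9,0,1,2,3,4,5,12,11,10],[6,7,8,9,10,11,12,5,4,0,1,2,3],[6,7,8,9,10,11,12,5,4,3,2,1,0]],
     Split [[8,7,6,5,4,3,2,1,0,9,10,11,12],[8,7,6,9,10,11,12,5,4,0,1,2,3]],
     Split [[10,11,12,5,4,3,2,1,0,9,6,7,8],[10,11,12,5,6,7,8,9,0,1,2,3,4],[10,11,12,5,6,7,8,9,0,4,3,2,1]],
     Split [[1,2,3,4,0,9,6,7,8,5,10,11,12],[1,2,3,4,0,9,10,11,12,5,6,7,8]],
     Split [[2,3,4,1,0,9,6,7,8,5,10,11,12],[2,3,4,1,0,9,10,11,12,5,6,7,8]],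
     Dominate [0,4,7,11], Dominate [0,2,7,11],
     Split [[2,3,4,0,1,5,6,7,8,9,10,11,12],[2,3,4,0,1,5,12,11,10,9,6,7,8]],
     Dominate [0,4,7,11], Dominate [4,2,7,11],
     Split [[10,11,12,9,0,1,2,3,4,5,6,7,8],[10,11,12,9,8,7,6,5,4,3,2,1,0]],
     Split [[12,11,10,3,2,1,0,9,8,7,6,5,4],[12,11,10,9,8,7,6,5,4,3,2,1,0]],
     Split [[0,1,2,3,4,5,6,7,8,9,10,11,12],[0,1,2,3,10,11,12,9,8,7,6,5,4]],
     Split [[4,5,6,7,8,9,0,1,2,3,10,11,12],[4,5,6,7,8,9,10,11,12,3,0,1,2]],
     Split [[6,5,4,7,8,9,0,1,2,3,10,11,12],[6,5,4,7,8,9,10,11,12,3,0,1,2]],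
     Split [[8,7,4,5,6,3,2,1,0,9,10,11,12],[8,7,6,5,4,3,10,11,12,9,0,1,2]],
     Dominate [0,3,8,10], Dominate [0,3,6,10],
     Split [[5,6,7,8,4,3,2,1,0,9,10,11,12],[5,6,7,8,4,3,10,11,12,9,0,1,2]],
     Split [[6,7,8,5,4,3,2,1,0,9,10,11,12],[6,7,8,5,4,3,10,11,12,9,0,1,2]],
     Dominate [1,4,8,11], Dominate [1,4,6,11],
     Split [[6,7,8,4,5,9,0,1,2,3,10,11,12],[6,7,8,4,5,9,10,11,12,3,0,1,2]],
     Dominate [1,6,8,11], Dominate [1,4,8,11],
     Split [[2,1,0,7,6,5,4,3,10,11,12,9,8],[2,1,0,9,10,11,12,3,4,5,6,7,8]],
     Split [[12,11,10,5,4,3,2,1,0,9,8,7,6],[12,11,10,9,8,7,6,5,4,3,2,1,0]],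
     Split [[0,1,2,3,4,5,6,7,8,9,10,11,12],[0,1,2,3,4,5,10,11,12,9,8,7,6]],
     Split [[2,1,0,3,4,5,6,7,8,9,10,11,12],[2,1,0,3,4,5,10,11,12,9,8,7,6]],
     Dominate [0,4,7,11],
     Split [[4,3,0,1,2,9,8,7,6,5,10,11,12],[4,3,2,1,0,9,10,11,12,5,6,7,8]],
     Dominate [9,4,6,10],
     Split [[6,7,8,9,0,1,2,3,4,5,10,11,12],[6,7,8,9,10,11,12,5,4,0,1,2,3],[6,7,8,9,10,11,12,5,4,3,2,1,0]],
     Split [[1,2,3,4,0,9,8,7,6,5,10,11,12],[1,2,3,4,0,9,10,11,12,5,6,7,8]],
     Split [[2,3,4,1,0,9,8,7,6,5,10,11,12],[2,3,4,1,0,9,10,11,12,5,6,7,8]],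
     Dominate [0,4,7,11], Dominate [0,2,7,11],
     Split [[2,3,4,0,1,5,6,7,8,9,10,11,12],[2,3,4,0,1,5,10,11,12,9,6,7,8]],
     Dominate [0,4,7,11], Dominate [4,2,7,11]]"
  by code_simp

lemma refutes_13_11: "refutes 13 11 [(0, 10) # path_edges 13]
     [Split [[12,11,10,0,1,2,3,4,5,6,7,8,9],[12,11,10,9,8,7,6,5,4,3,2,1,0]],
     Split [[11,12,3,2,1,0,10,9,8,7,6,5,4],[11,12,3,4,5,6,7,8,9,10,0,1,2]],
     Split [[12,11,7,6,5,4,3,2,1,0,10,9,8],[12,11,7,8,9,10,0,1,2,3,4,5,6],[12,11,10,9,8,7,6,5,4,3,2,1,0]],
     Split [[11,12,6,5,4,3,2,1,0,10,9,8,7],[11,12,6,7,8,9,10,0,1,2,3,4,5]],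
     Split [[12,11,2,1,0,10,9,8,7,6,5,4,3],[12,11,2,3,4,5,6,7,8,9,10,0,1],[12,11,10,0,1,2,3,4,5,6,7,8,9]]]"
  by code_simp

lemma refutes_13_13: "refutes 13 13 [(0, 12) # path_edges 13]
     [Split [[0,1,2,3,4,5,6,7,8,9,10,11,12]],
     Split [[1,0,12,11,10,9,8,7,6,5,4,3,2],[1,2,3,0,12,11,10,9,8,7,6,5,4]],
     Split [[2,1,0,3,4,5,6,7,8,9,10,11,12],[2,1,4,3,0,12,11,10,9,8,7,6,5],[2,1,0,12,11,10,9,8,7,6,5,4,3]],
     Split [[5,4,3,2,1,0,12,11,10,9,8,7,6]], Dominate [3,5,8,11], Dominate [0,5,7,10],
     Dominate [0,1,5,10], Dominate [3,7,5,11], Dominate [0,1,5,9], Dominate [3,7,5,10],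
     Split [[12,0,1,2,3,4,5,6,7,8,9,10,11]], Dominate [12,10,4,7], Dominate [1,12,5,8],
     Dominate [3,10,5,7], Dominate [1,4,12,8], Dominate [3,10,5,8], Dominate [1,4,7,12],
     Split [[2,1,0,12,11,10,9,8,7,6,5,4,3]], Dominate [0,2,7,10], Dominate [4,2,8,11],
     Dominate [0,2,6,10], Dominate [4,2,7,11], Dominate [0,2,6,9], Dominate [4,2,7,10],
     Split [[8,7,6,5,4,3,2,1,0,12,11,10,9]], Dominate [6,8,3,11], Dominate [0,8,4,10],
     Dominate [6,2,8,11], Dominate [0,3,8,10],
     Split [[9,8,7,6,5,4,3,2,1,0,12,11,10],[9,10,11,8,7,6,5,4,3,2,1,0,12]], Dominate [0,9,4,8],
     Dominate [0,3,9,8],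
     Split [[10,9,8,7,6,5,4,3,2,1,0,12,11],[10,9,8,11,12,0,1,2,3,4,5,6,7],[10,9,12,11,8,7,6,0,1,2,3,4,5]],
     Split [[10,9,8,7,6,5,4,3,2,1,0,12,11]], Dominate [10,2,5,8], Dominate [6,10,3,8],
     Dominate [1,10,5,8], Dominate [6,2,10,8], Dominate [1,4,10,8], Dominate [12,2,5,10],
     Split [[2,1,0,12,11,10,9,8,7,6,5,4,3]],
     Split [[3,2,1,0,12,11,10,9,8,7,6,5,4],[3,4,5,2,1,0,12,11,10,9,8,7,6]],
     Split [[4,3,2,1,0,12,11,10,9,8,7,6,5],[4,3,2,5,6,7,8,9,10,11,12,0,1],[4,3,6,5,2,1,0,7,8,9,10,11,12]],
     Dominate [0,5,9,10], Dominate [0,5,12,9], Split [[4,3,2,1,0,12,11,10,9,8,7,6,5]],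
     Dominate [4,2,8,11], Dominate [12,4,6,9], Dominate [12,2,4,9], Dominate [0,2,4,10],
     Dominate [12,2,4,8], Dominate [0,2,4,9], Dominate [0,2,5,10], Dominate [7,2,4,11],
     Dominate [0,2,5,9], Dominate [7,2,4,10], Split [[11,10,9,8,7,6,5,4,3,2,1,0,12]],
     Dominate [9,11,3,6], Dominate [0,11,4,7], Dominate [9,2,11,6], Dominate [0,3,11,7],
     Dominate [9,2,5,11], Dominate [0,3,6,11],
     Split [[11,10,9,8,7,6,5,4,3,2,1,0,12],[11,12,0,10,9,8,7,6,5,4,3,2,1]],
     Split [[12,0,1,2,3,4,5,6,7,8,9,10,11],[12,0,1,11,10,9,8,7,6,5,4,3,2],[12,0,10,11,1,2,3,4,5,6,7,8,9]],
     Split [[2,1,0,12,11,10,9,8,7,6,5,4,3]], Dominate [0,5,4,8], Dominate [0,2,4,8],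
     Dominate [0,8,4,5], Dominate [0,2,4,7], Dominate [0,2,5,8], Dominate [10,2,4,7],
     Split [[9,8,7,6,5,4,3,2,1,0,10,11,12]], Dominate [0,1,4,7], Dominate [0,2,4,7],
     Dominate [0,3,4,7], Dominate [0,2,5,7], Dominate [0,3,6,7], Dominate [1,4,7,9]]"
  by code_simp

text \<open>Position 2 is excluded, so that only positions 1 and 3 remain for neighbors of the
  start: too few for degree 3.\<close>

lemma refutes_small:
  assumes "N \<in> {4, 7, 10, 13}" "i \<in> {2, 4}"
  shows "refutes N i [(0, i - 1) # path_edges N] [Split [[0..<N]]]"
proof -
  have "refutes 4 2 [(0, 1) # path_edges 4] [Split [[0..<4]]]"
    and "refutes 4 4 [(0, 3) # path_edges 4] [Split [[0..<4]]]"
    and "refutes 7 2 [(0, 1) # path_edges 7] [Split [[0..<7]]]"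
    and "refutes 7 4 [(0, 3) # path_edges 7] [Split [[0..<7]]]"
    and "refutes 10 2 [(0, 1) # path_edges 10] [Split [[0..<10]]]"
    and "refutes 10 4 [(0, 3) # path_edges 10] [Split [[0..<10]]]"
    and "refutes 13 2 [(0, 1) # path_edges 13] [Split [[0..<13]]]"
    and "refutes 13 4 [(0, 3) # path_edges 13] [Split [[0..<13]]]"
    by code_simp+
  then show ?thesis using assms by auto
qed

context min_degree_3_graph
begin

section \<open>Application to closed members\<close>

lemma every_third_2_all_but_hd:
  assumes "ham_path U (x # xs)" "card U mod 3 = 1"
  shows "U - {x} \<subseteq> dominated_by (every_third 2 (x # xs))"
    and "card (every_third 2 (x # xs)) \<le> card U div 3"
    and "every_third 2 (x # xs) \<subseteq> U"
proof -
  have len: "length (x # xs) = card U" by (rule ham_path_length[OF assms(1)])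
  show "U - {x} \<subseteq> dominated_by (every_third 2 (x # xs))"
  proof
    fix v assume v: "v \<in> U - {x}"
    then have "v \<in> set (x # xs)" using assms(1) by (simp add: ham_path_def)
    then obtain j where j: "j < length (x # xs)" "(x # xs) ! j = v" by (auto simp only: in_set_conv_nth)
    have "0 < j" using v j(2) by (cases j) auto
    moreover have "Suc j < length (x # xs) \<or> j mod 3 \<noteq> 1"
    proof (rule ccontr)
      assume "\<not> ?thesis"
      then have "Suc j = card U" "j mod 3 = 1" using j(1) len by linarith+
      then show False using assms(2) mod_Suc[of j 3] by simp
    qed
    ultimately show "v \<in> dominated_by (every_third 2 (x # xs))"
      using every_third_2_dominates[OF assms(1) _ j(1)] j(2) by blast
  qed
  show "card (every_third 2 (x # xs)) \<le> card U div 3"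
    using card_every_third[of 2 "x # xs"] len by simp
  show "every_third 2 (x # xs) \<subseteq> U"
    using every_third_subset[of 2 "x # xs"] assms(1) by (simp add: ham_path_def)
qed

text \<open>A chord from the start to a residue 2 would make the positions 2 modulo 3 a dominating
  set. In a counterexample there is no such chord on any Hamiltonian path, which is what the
  refutations assume.\<close>

lemma closed_order_1_mod_3_dominated:
  assumes card: "card U \<in> {1, 4, 7, 10, 13}" and U: "U \<subseteq> V" and xs: "ham_path U xs" and closed: "open_ends U = {}"
  shows "\<exists>D\<subseteq>U. card D \<le> card U div 3 \<and> U \<subseteq> dominated_by D"
proof (rule ccontr)
  assume not: "\<not> ?thesis"
  define N where "N = card U"
  have len: "length ys = N" if "ham_path U ys" for ys using ham_path_length[OF that] N_def by simp
  have N: "0 < N" "N mod 3 = 1" using card by (auto simp: N_def)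
  have hd0: "hd ys = ys ! 0" "ys = ys ! 0 # tl ys" if "ham_path U ys" for ys
    using len[OF that] N(1) by (cases ys; simp)+
  have nbrs: "v \<in> U" if "ham_path U ys" "E (ys ! 0) v" for ys v
    using closed_end_neighbors[of U "ys ! 0" "tl ys" v] hd0(2)[OF that(1)] that closed by auto
  have chord: "j mod 3 \<noteq> 2" if ys: "ham_path U ys" "j < N" "E (ys ! 0) (ys ! j)" for ys j
  proof
    assume j: "j mod 3 = 2"
    let ?D = "every_third 2 ys"
    obtain y zs where y: "ys = y # zs" using hd0(2)[OF ys(1)] by metis
    note third = every_third_2_all_but_hd[OF ys(1)[unfolded y] N(2)[unfolded N_def]]
    have "ys ! j \<in> ?D" using nth_in_every_third[of j ys 2] j ys(2) len[OF ys(1)] by simp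
    then have "y \<in> dominated_by ?D" using ys(3) y E_sym by (auto simp: dominated_by_def)
    then have "U \<subseteq> dominated_by ?D" using third(1) y by blast
    moreover have "card ?D \<le> card U div 3" "?D \<subseteq> U" using third(2,3) y by simp_all
    ultimately show False using not by blast
  qed
  \<comment> \<open>Taking the farthest neighbor \<open>m\<close> that the start of a Hamiltonian path can have keeps the
    refutations small.\<close>
  define P where "P j \<longleftrightarrow> (\<exists>ys. ham_path U ys \<and> j < N \<and> E (ys ! 0) (ys ! j))" for j
  have "xs ! 0 \<in> V" using xs U hd0(2)[OF xs] by (auto simp: ham_path_def dest: arg_cong[of _ _ set])
  then obtain z where z: "E (xs ! 0) z" by (rule third_neighbor)
  then obtain j where "j < length xs" "xs ! j = z"
    using nbrs[OF xs] xs by (metis ham_path_def in_set_conv_nth)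
  then have "P j" using z xs len[OF xs] by (auto simp: P_def)
  moreover have "\<forall>j. P j \<longrightarrow> j \<le> N" by (auto simp: P_def)
  ultimately obtain m where m: "P m" "\<And>j. P j \<Longrightarrow> j \<le> m"
    using Greatest_le_nat[of P _ N] GreatestI_nat[of P _ N] by blast
  obtain ys where ys: "ham_path U ys" "m < N" "E (ys ! 0) (ys ! m)" using m(1) P_def by blast
  \<comment> \<open>Vertices are renamed by their positions on \<open>ys\<close>, which turns this
    path into 0, ..., N - 1 and its longest chord into \<open>(0, m)\<close>.\<close>
  define e where "e a b \<longleftrightarrow> a < N \<and> b < N \<and> E (ys ! a) (ys ! b)" for a b
  have transfer: "ham_path U (map ((!) ys) p)" "p \<noteq> []" "length p = N"
    if p: "distinct p" "set p = {..<N}" "successively e p" for p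
  proof -
    have inj: "inj_on ((!) ys) {..<N}"
      using ys(1) len[OF ys(1)] by (auto simp: ham_path_def inj_on_def nth_eq_iff_index_eq)
    have "set (map ((!) ys) p) = U"
      using p(2) ys(1) len[OF ys(1)] nth_image[of N ys] by (simp add: ham_path_def lessThan_atLeast0)
    moreover have "distinct (map ((!) ys) p)" using p(1,2) inj by (simp add: distinct_map)
    moreover have "successively E (map ((!) ys) p)"
      unfolding successively_map using p(3) by (rule successively_mono) (simp add: e_def)
    ultimately show "ham_path U (map ((!) ys) p)" by (simp add: ham_path_def)
    show "length p = N" using p(1,2) distinct_card[of p] by simp
    then show "p \<noteq> []" using N(1) by auto
  qed
  have start: "map ((!) ys) p ! 0 = ys ! hd p" if "p \<noteq> []" for p using that by (cases p) auto
  have sound: False if ref: "refutes N (Suc m) [(0, m) # path_edges N] c" for c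
  proof -
    have "\<exists>D\<subseteq>{..<N}. card D \<le> N div 3 \<and> (\<forall>v<N. \<exists>d\<in>D. d = v \<or> e d v)"
    proof (rule refutes_sound[OF _ _ _ _ ref])
      show "e b a" if "e a b" for a b using that E_sym by (auto simp: e_def)
      show "\<not> e a a" for a using E_irrefl by (auto simp: e_def)
      show "j mod 3 \<noteq> 2 \<and> j < Suc m"
        if p: "distinct p" "set p = {..<N}" "successively e p" and j: "j < N" "e (hd p) (p ! j)" for p j
      proof -
        note t = transfer[OF p]
        have "E (map ((!) ys) p ! 0) (map ((!) ys) p ! j)"
          using start[OF t(2)] j t(3) by (simp add: e_def)
        then show ?thesis using chord[OF t(1) j(1)] m(2)[of j] t(1) j(1) by (auto simp: P_def less_Suc_eq_le)
      qed
      show "3 \<le> card {w. w < N \<and> e (hd p) w}"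
        if p: "distinct p" "set p = {..<N}" "successively e p" for p
      proof -
        note t = transfer[OF p]
        have hd: "hd p < N" using p(2) t(2) hd_in_set by blast
        have "{v. E (ys ! hd p) v} \<subseteq> (!) ys ` {w. w < N \<and> e (hd p) w}"
        proof
          fix v assume "v \<in> {v. E (ys ! hd p) v}"
          then have v: "E (ys ! hd p) v" by simp
          then have "v \<in> U" using nbrs[OF t(1)] start[OF t(2)] by simp
          then obtain l where "l < N" "ys ! l = v"
            using ys(1) len[OF ys(1)] by (metis ham_path_def in_set_conv_nth)
          then show "v \<in> (!) ys ` {w. w < N \<and> e (hd p) w}" using v hd by (auto simp: e_def)
        qed
        then have "card {v. E (ys ! hd p) v} \<le> card {w. w < N \<and> e (hd p) w}"
          using surj_card_le[of "{w. w < N \<and> e (hd p) w}"] by simp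
        moreover have "ys ! hd p \<in> V"
          using hd ys(1) U len[OF ys(1)] nth_mem[of "hd p" ys] by (auto simp: ham_path_def)
        ultimately show ?thesis using degree_ge_3 by fastforce
      qed
      show "(0, m) # path_edges N \<in> set [(0, m) # path_edges N]" by simp
      show "e a b" if "(a, b) \<in> set ((0, m) # path_edges N)" for a b
        using that ys(2,3) N(1) ham_path_nth_E[OF ys(1)] len[OF ys(1)] by (auto simp: path_edges_def e_def)
    qed
    then obtain D where D: "D \<subseteq> {..<N}" "card D \<le> N div 3" "\<forall>v<N. \<exists>d\<in>D. d = v \<or> e d v" by blast
    have "(!) ys ` D \<subseteq> U" using D(1) ys(1) len[OF ys(1)] by (auto simp: ham_path_def)
    moreover have "card ((!) ys ` D) \<le> card U div 3"
      using card_image_le[of D "(!) ys"] finite_subset[OF D(1)] D(2) N_def by simp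
    moreover have "U \<subseteq> dominated_by ((!) ys ` D)"
    proof
      fix v assume "v \<in> U"
      then obtain l where "l < N" "ys ! l = v"
        using ys(1) len[OF ys(1)] by (metis ham_path_def in_set_conv_nth)
      then show "v \<in> dominated_by ((!) ys ` D)" using D(3) by (auto simp: e_def dominated_by_def)
    qed
    ultimately show False using not by blast
  qed
  have "m \<noteq> 0" using ys(3) E_irrefl by metis
  moreover have "m mod 3 \<noteq> 2" using chord[OF ys] .
  moreover have "N \<in> {1, 4, 7, 10, 13}" using card N_def by simp
  ultimately consider "N \<in> {4, 7, 10, 13}" "Suc m \<in> {2, 4}"
    | "N = 7" "m = 4" | "N = 7" "m = 6"
    | "N = 10" "m = 4" | "N = 10" "m = 6" | "N = 10" "m = 7" | "N = 10" "m = 9"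
    | "N = 13" "m = 4" | "N = 13" "m = 6" | "N = 13" "m = 7" | "N = 13" "m = 9" | "N = 13" "m = 10" | "N = 13" "m = 12"
  proof -
    have "m = 1 \<or> m = 2 \<or> m = 3 \<or> m = 4 \<or> m = 5 \<or> m = 6 \<or> m = 7 \<or> m = 8 \<or> m = 9 \<or> m = 10 \<or> m = 11 \<or> m = 12"
    proof -
      have "m < 13" using ys(2) \<open>N \<in> {1, 4, 7, 10, 13}\<close> by auto
      then show ?thesis using \<open>m \<noteq> 0\<close> by presburger
    qed
    then show thesis using that \<open>m mod 3 \<noteq> 2\<close> \<open>N \<in> {1, 4, 7, 10, 13}\<close> ys(2) by (elim disjE) auto
  qed
  then show False
    by cases (use sound refutes_small[of N "Suc m"] refutes_7_5 refutes_7_7 refutes_10_5 refutes_10_7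
      refutes_10_8 refutes_10_10 refutes_13_5 refutes_13_7 refutes_13_8 refutes_13_10 refutes_13_11
      refutes_13_13 in \<open>auto simp del: refutes.simps\<close>)
qed

end

section \<open>Reed's bound\<close>

text \<open>\<open>Y\<close> maximizes the collected \<open>h\<close> minus 5 for each element. Then
  a further \<open>g\<close> gains at most 5, so it is adjacent neither to two members of
  \<open>W\<close> that are not hit, as 3 + 3 > 5, nor to one with \<open>h\<close> above 5. Hence
  the members that are not hit have disjoint neighborhoods outside of \<open>Y\<close>, and separate
  parts of \<open>w\<close> cover their \<open>d\<close>.\<close>

lemma accepting_selection:
  fixes w :: "'g \<Rightarrow> int" and h d :: "'u \<Rightarrow> int"
  assumes fin: "finite S" "finite W"
    and w: "\<And>g. g \<in> S \<Longrightarrow> 0 \<le> w g" and h: "\<And>u. u \<in> W \<Longrightarrow> 3 \<le> h u"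
    and d: "\<And>u. u \<in> W \<Longrightarrow> (5 < h u \<and> (\<exists>g\<in>S. adj u g)) \<or> d u \<le> (\<Sum>g\<in>{g\<in>S. adj u g}. w g)"
  shows "\<exists>Y\<subseteq>S. 0 \<le> (\<Sum>g\<in>S. if g \<in> Y then -5 else w g) + (\<Sum>u\<in>W. if \<exists>g\<in>Y. adj u g then h u else - d u)"
proof -
  define hit where "hit Y = {u \<in> W. \<exists>g\<in>Y. adj u g}" for Y
  define F where "F Y = (\<Sum>u\<in>hit Y. h u) - 5 * int (card Y)" for Y
  have "finite (F ` Pow S)" "F ` Pow S \<noteq> {}" using fin by auto
  then have "Max (F ` Pow S) \<in> F ` Pow S" "\<And>Y. Y \<subseteq> S \<Longrightarrow> F Y \<le> Max (F ` Pow S)"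
    using Max_in by (blast, intro Max_ge) auto
  then obtain Y where Y: "Y \<subseteq> S" "\<And>Y'. Y' \<subseteq> S \<Longrightarrow> F Y' \<le> F Y" by auto
  have finY: "finite Y" using Y(1) fin(1) finite_subset by blast
  have finhit: "finite (hit Y)" for Y using fin(2) by (simp add: hit_def)
  have add: "(\<Sum>u\<in>T. h u) \<le> 5" if g: "g \<in> S - Y" and T: "T \<subseteq> {u \<in> W - hit Y. adj u g}" for g T
  proof -
    have sub: "hit Y \<union> T \<subseteq> hit (insert g Y)" using T by (auto simp: hit_def)
    have finT: "finite T" using finite_subset[OF T] fin(2) by simp
    have "(\<Sum>u\<in>hit Y. h u) + (\<Sum>u\<in>T. h u) = (\<Sum>u\<in>hit Y \<union> T. h u)"
      using T finT finhit by (intro sum.union_disjoint[symmetric]) auto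
    also have "\<dots> \<le> (\<Sum>u\<in>hit (insert g Y). h u)"
    proof (rule sum_mono2[OF finhit sub])
      show "0 \<le> h u" if "u \<in> hit (insert g Y) - (hit Y \<union> T)" for u
        using h[of u] that by (auto simp: hit_def)
    qed
    finally have "(\<Sum>u\<in>hit Y. h u) + (\<Sum>u\<in>T. h u) \<le> (\<Sum>u\<in>hit (insert g Y). h u)" .
    moreover have "F (insert g Y) \<le> F Y" using Y g by auto
    moreover have "card (insert g Y) = Suc (card Y)" using g finY by simp
    ultimately show ?thesis by (simp add: F_def)
  qed
  define N where "N u = {g \<in> S. adj u g}" for u
  have N: "N u \<subseteq> S - Y" if "u \<in> W - hit Y" for u using that by (auto simp: N_def hit_def)
  have disj: "N u \<inter> N v = {}" if uv: "u \<in> W - hit Y" "v \<in> W - hit Y" "u \<noteq> v" for u v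
  proof (rule ccontr)
    assume "N u \<inter> N v \<noteq> {}"
    then obtain g where g: "g \<in> S" "adj u g" "adj v g" by (auto simp: N_def)
    then have "g \<in> S - Y" using N[OF uv(1)] by (auto simp: N_def)
    from add[OF this, of "{u, v}"] have "h u + h v \<le> 5" using g uv by auto
    then show False using h[of u] h[of v] uv by auto
  qed
  have du: "d u \<le> sum w (N u)" if u: "u \<in> W - hit Y" for u
  proof (rule ccontr)
    assume "\<not> ?thesis"
    then obtain g where g: "5 < h u" "g \<in> S" "adj u g" using d[of u] u by (auto simp: N_def)
    then have "g \<in> S - Y" using N[OF u] by (auto simp: N_def)
    from add[OF this, of "{u}"] show False using g u by auto
  qed
  have "(\<Sum>u\<in>W - hit Y. d u) \<le> (\<Sum>u\<in>W - hit Y. sum w (N u))" using du by (rule sum_mono)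
  also have "\<dots> = sum w (\<Union>(N ` (W - hit Y)))"
    using fin disj by (intro sum.UNION_disjoint[symmetric]) (auto simp: N_def)
  also have "\<dots> \<le> sum w (S - Y)"
    using N fin(1) w by (intro sum_mono2) auto
  finally have 1: "(\<Sum>u\<in>W - hit Y. d u) \<le> sum w (S - Y)" .
  \<comment> \<open>Comparison with the empty selection: the accepted elements are paid for by what
    they hit.\<close>
  have "F {} \<le> F Y" using Y(2) by simp
  then have 2: "0 \<le> (\<Sum>u\<in>hit Y. h u) - 5 * int (card Y)" by (simp add: F_def hit_def)
  have "(\<Sum>g\<in>S. if g \<in> Y then -5 else w g) =
      (\<Sum>g\<in>Y. if g \<in> Y then -5 else w g) + (\<Sum>g\<in>S - Y. if g \<in> Y then -5 else w g)"
    using sum.subset_diff[OF Y(1) fin(1), of "\<lambda>g. if g \<in> Y then -5 else w g"] by (simp only: add.commute)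
  also have "\<dots> = sum w (S - Y) - 5 * int (card Y)" by simp
  finally have 3: "(\<Sum>g\<in>S. if g \<in> Y then -5 else w g) = sum w (S - Y) - 5 * int (card Y)" .
  let ?f = "\<lambda>u. if \<exists>g\<in>Y. adj u g then h u else - d u"
  have "(\<Sum>u\<in>W. ?f u) = (\<Sum>u\<in>hit Y. ?f u) + (\<Sum>u\<in>W - hit Y. ?f u)"
    using sum.subset_diff[of "hit Y" W ?f] fin(2) by (simp add: hit_def add.commute)
  also have "(\<Sum>u\<in>hit Y. ?f u) = (\<Sum>u\<in>hit Y. h u)" by (rule sum.cong) (auto simp: hit_def)
  also have "(\<Sum>u\<in>W - hit Y. ?f u) = (\<Sum>u\<in>W - hit Y. - d u)" by (rule sum.cong) (auto simp: hit_def)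
  finally have "(\<Sum>u\<in>W. ?f u) = (\<Sum>u\<in>hit Y. h u) - (\<Sum>u\<in>W - hit Y. d u)" by (simp add: sum_negf)
  then show ?thesis using 1 2 3 Y(1) by (intro exI[of _ Y]) simp
qed

context min_degree_3_graph
begin

section \<open>Members whose costs are balanced against each other\<close>

definition special :: "'a set \<Rightarrow> bool" where
  "special U \<longleftrightarrow> open_ends U = {} \<and> card U \<in> {17, 20} \<and> \<not> self_dominating U"

definition cheap :: "'a set \<Rightarrow> bool" where
  "cheap U \<longleftrightarrow> (\<exists>D\<subseteq>U. 8 * card D \<le> 3 * card U \<and> U \<subseteq> dominated_by D)"

definition reaches :: "'a set \<Rightarrow> 'a set \<Rightarrow> bool" where
  "reaches U U' \<longleftrightarrow> (\<exists>x\<in>open_ends U. \<exists>y\<in>U'. E x y)"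

text \<open>Such a member can save a vertex only if a special member takes all its anchors, at an
  additional cost.\<close>

definition stuck :: "'a set set \<Rightarrow> 'a set \<Rightarrow> bool" where
  "stuck C U \<longleftrightarrow> card U mod 3 = 1 \<and> \<not> cheap U \<and>
     (\<forall>x\<in>open_ends U. \<forall>y. E x y \<longrightarrow> y \<notin> U \<longrightarrow> (\<exists>g\<in>C. special g \<and> y \<in> g))"

text \<open>Once a special member that it reaches contributes its anchors, all four vertices are
  dominated from outside; this is where the 12 = 3 * 4 in \<open>slack\<close> comes from.\<close>

definition lone :: "'a set set \<Rightarrow> 'a set \<Rightarrow> bool" where
  "lone C U \<longleftrightarrow> card U = 4 \<and> (\<forall>g\<in>C. special g \<longrightarrow> reaches U g \<longrightarrow>
     (\<forall>v\<in>U. v \<in> open_ends U \<and> (\<exists>y\<in>g. E v y)))"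

lemma card_1_mod_3_cases:
  fixes n :: nat
  assumes "n mod 3 = 1"
  shows "n \<in> {1, 4, 7, 10, 13} \<or> 16 \<le> n"
proof -
  obtain q where q: "n = 3 * q + 1" using assms mult_div_mod_eq[of 3 n] by metis
  have "q = 0 \<or> q = 1 \<or> q = 2 \<or> q = 3 \<or> q = 4 \<or> 5 \<le> q" by linarith
  then show ?thesis using q by auto
qed

text \<open>For order 3k + 1, the k + 1 vertices of the plain construction satisfy 8(k + 1) \<le>
  3(3k + 1) as soon as k \<ge> 5, which leaves only the five orders; for these, closed members are
  dominated by k vertices.\<close>

lemma not_cheap:
  assumes "card U mod 3 = 1" "U \<subseteq> V" "ham_path U xs" "\<not> cheap U"
  shows "card U \<in> {1, 4, 7, 10, 13}" "open_ends U \<noteq> {}"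
proof -
  obtain x zs where xs: "xs = x # zs" using assms(1,3) by (cases xs) (auto simp: ham_path_def)
  note third = every_third_2_all_but_hd[OF assms(3)[unfolded xs] assms(1)]
  show 1: "card U \<in> {1, 4, 7, 10, 13}"
  proof (rule ccontr)
    assume "\<not> ?thesis"
    then have "16 \<le> card U" using card_1_mod_3_cases[OF assms(1)] by blast
    let ?D = "insert x (every_third 2 xs)"
    have "card ?D \<le> card U div 3 + 1" using card_insert_le_Suc[of x "every_third 2 xs"] third(2) xs by simp
    then have "8 * card ?D \<le> 3 * card U"
      using \<open>16 \<le> card U\<close> assms(1) mult_div_mod_eq[of 3 "card U"] by linarith
    moreover have "?D \<subseteq> U" using third(3) assms(3) xs by (auto simp: ham_path_def)
    moreover have "U \<subseteq> dominated_by ?D"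
      using third(1) dominated_by_mono[of "every_third 2 xs" ?D] xs by (auto simp: dominated_by_def)
    ultimately show False using assms(4) unfolding cheap_def by blast
  qed
  show "open_ends U \<noteq> {}"
  proof
    assume "open_ends U = {}"
    then obtain D where "D \<subseteq> U" "card D \<le> card U div 3" "U \<subseteq> dominated_by D"
      using closed_order_1_mod_3_dominated[OF 1 assms(2,3)] by blast
    then show False using assms(4) unfolding cheap_def by auto
  qed
qed

text \<open>One dominating vertex would make \<open>U\<close> cheap. So no end is adjacent to the
  vertex at position 2, and its degree forces edges to \<open>y\<close> and to the other end. The
  latter closes a 4-cycle, so that every vertex is an end.\<close>

lemma order_4_all_ends_open:
  assumes card: "card U = 4" and U: "U \<subseteq> V" and xs: "ham_path U xs" and not: "\<not> cheap U"
    and nbr: "\<And>x z. x \<in> open_ends U \<Longrightarrow> E x z \<Longrightarrow> z \<notin> U \<Longrightarrow> z = y"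
  shows "v \<in> U \<Longrightarrow> v \<in> open_ends U \<and> E v y"
proof -
  have one: False if "d \<in> U" "\<And>u. u \<in> U \<Longrightarrow> u = d \<or> E d u" for d
  proof -
    have "U \<subseteq> dominated_by {d}" using that(2) by (auto simp: dominated_by_def)
    then show False using not that(1) card unfolding cheap_def by (auto dest!: spec[of _ "{d}"])
  qed
  have end4: "b1 \<in> open_ends U \<and> E b1 y \<and> E b1 b4"
    if b: "ham_path U [b1, b2, b3, b4]" for b1 b2 b3 b4
  proof -
    have path: "U = {b1, b2, b3, b4}" "E b1 b2" "E b2 b3" "E b3 b4" using b by (auto simp: ham_path_def)
    have V: "b1 \<in> V" using path U by auto
    have n3: "\<not> E b1 b3"
    proof
      assume "E b1 b3"
      then show False using one[of b3] path E_sym by auto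
    qed
    have end_open: "b1 \<in> open_ends U"
    proof (rule ccontr)
      assume "b1 \<notin> open_ends U"
      then have "{v. E b1 v} \<subseteq> {b2, b3, b4}" using closed_end_neighbors[OF b] path(1) E_irrefl by auto
      then show False using closed_vertex_neighbors(2)[OF V] n3 by blast
    qed
    then have "{v. E b1 v} \<subseteq> {b2, y, b4}" using nbr[OF end_open] path(1) n3 E_irrefl by auto
    from closed_vertex_neighbors[OF V this] end_open show ?thesis by blast
  qed
  have "length xs = Suc (Suc (Suc (Suc 0)))" using ham_path_length[OF xs] card by simp
  then obtain a1 a2 a3 a4 where "xs = [a1, a2, a3, a4]" by (auto simp only: length_Suc_conv length_0_conv)
  then have a: "ham_path U [a1, a2, a3, a4]" using xs by simp
  note e = end4[OF a]
  have r: "ham_path U [a4, a3, a2, a1]" using ham_path_rev[OF a] by simp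
  have a2: "ham_path U [a2, a1, a4, a3]" and a3: "ham_path U [a3, a4, a1, a2]"
    using a e E_commute by (auto simp: ham_path_def)
  show "v \<in> open_ends U \<and> E v y" if "v \<in> U"
    using that e end4[OF r] end4[OF a2] end4[OF a3] a by (auto simp: ham_path_def)
qed


text \<open>Two reached members give at least 3 + 3. If only one is reached, order 1 is impossible:
  three neighbors would have to be among at most two anchors. Order 4 needs weight 4, as offered by
  order 20; order 17 has at most one anchor, and then \<open>order_4_all_ends_open\<close> makes
  \<open>U\<close> lone. From order 7 on, 3 is enough.\<close>

lemma stuck_weight:
  assumes opt: "optimal_cover C" and U: "U \<in> C" "stuck C U"
  defines "S \<equiv> {g \<in> C. special g}"
  shows "\<exists>g\<in>S. reaches U g"
    and "lone C U \<or> 5 - int (card U div 3) \<le> (\<Sum>g\<in>{g \<in> S. reaches U g}. if card g = 17 then 3 else 4)"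
proof -
  have pc: "path_cover C" using opt by (simp add: optimal_cover_def)
  have UV: "U \<subseteq> V" by (rule path_cover_subset[OF pc U(1)])
  obtain xs where xs: "ham_path U xs" using pc U(1) unfolding path_cover_def by blast
  have stuck: "card U mod 3 = 1" "\<not> cheap U" using U(2) by (auto simp: stuck_def)
  note nc = not_cheap[OF stuck(1) UV xs stuck(2)]
  define N where "N = {g \<in> S. reaches U g}"
  have finC: "finite C" using pc finite_V finite_elements unfolding path_cover_def by blast
  then have finN: "finite N" by (simp add: N_def S_def)
  have nbr: "\<exists>g\<in>N. z \<in> g \<and> z \<in> anchors g" if z: "x \<in> open_ends U" "E x z" "z \<notin> U" for x z
  proof -
    obtain g where g: "g \<in> C" "special g" "z \<in> g" using U(2) z unfolding stuck_def by blast
    then have "U \<noteq> g" using z(3) by blast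
    then have "z \<in> anchors g" using open_end_neighbor_anchor[OF opt U(1) g(1) _ _ z(1,2) g(3)] stuck(1) by simp
    then show ?thesis using g z unfolding N_def S_def reaches_def by blast
  qed
  obtain x y0 where x: "x \<in> open_ends U" "E x y0" "y0 \<notin> U" using nc(2) unfolding open_ends_def by blast
  obtain g0 where g0: "g0 \<in> N" "y0 \<in> g0" using nbr[OF x] by blast
  then show "\<exists>g\<in>S. reaches U g" unfolding N_def by blast
  let ?w = "\<lambda>g::'a set. if card g = 17 then 3 else 4 :: int"
  have ge: "?w g0 \<le> sum ?w N" using member_le_sum[OF g0(1), of ?w] finN by simp
  have "lone C U \<or> 5 - int (card U div 3) \<le> sum ?w N"
  proof (cases "N = {g0}")
    case False
    then obtain g1 where "g1 \<in> N" "g1 \<noteq> g0" using g0(1) by blast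
    then have "sum ?w {g0, g1} \<le> sum ?w N" using g0(1) finN by (intro sum_mono2) auto
    then show ?thesis using \<open>g1 \<noteq> g0\<close> by (auto split: if_splits)
  next
    case N: True
    have "special g0" "g0 \<in> C" using g0(1) by (auto simp: N_def S_def)
    then have g0V: "g0 \<subseteq> V" "open_ends g0 = {}" "\<not> self_dominating g0" "card g0 = 17 \<or> card g0 = 20"
      using path_cover_subset[OF pc] by (auto simp: special_def)
    obtain ys where ys: "ham_path g0 ys" using pc \<open>g0 \<in> C\<close> unfolding path_cover_def by blast
    note anchors = card_closed_anchors[OF g0V(1) ys g0V(2,3)]
    consider "card U = 1" | "card U = 4" "card g0 = 17" | "card U = 4" "card g0 = 20" | "7 \<le> card U"
      using nc(1) g0V(4) by auto
    then show ?thesis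
    proof cases
      case 1
      then have "U = {x}" using x(1) open_ends_subset by (metis card_1_singletonE empty_iff insertE subsetD)
      then have "{v. E x v} \<subseteq> anchors g0" using nbr[OF x(1)] N E_irrefl by auto
      moreover obtain y z where "anchors g0 \<subseteq> {y, z}" using anchors g0V(4) by blast
      ultimately have "{v. E x v} \<subseteq> {y, z}" by blast
      moreover have "x \<in> V" using x(2) E_in_V by blast
      ultimately have False by (metis third_neighbor insertE mem_Collect_eq singletonD subsetD)
      then show ?thesis ..
    next
      case 2
      obtain y where y: "anchors g0 \<subseteq> {y}" using anchors(1) 2(2) by blast
      have eq_y: "z = y" if "x \<in> open_ends U" "E x z" "z \<notin> U" for x z using nbr[OF that] N y by auto
      have all: "v \<in> open_ends U \<and> E v y" if "v \<in> U" for v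
        by (rule order_4_all_ends_open[OF 2(1) UV xs stuck(2) _ that]) (rule eq_y)
      have "y \<in> g0" using nbr[OF x] N y by auto
      have "lone C U"
        unfolding lone_def
      proof (intro conjI ballI impI)
        show "card U = 4" by (rule 2(1))
        fix g v assume "g \<in> C" "special g" "reaches U g" and v: "v \<in> U"
        then have "g \<in> N" unfolding N_def S_def by blast
        then have "g = g0" using N by simp
        then show "v \<in> open_ends U" "\<exists>y\<in>g. E v y" using all[OF v] \<open>y \<in> g0\<close> by blast+
      qed
      then show ?thesis ..
    next
      case 3
      then show ?thesis using ge by simp
    next
      case 4
      then show ?thesis using ge by (auto split: if_splits)
    qed
  qed
  then show "lone C U \<or> 5 - int (card U div 3) \<le> (\<Sum>g\<in>{g \<in> S. reaches U g}. if card g = 17 then 3 else 4)"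
    by (simp only: N_def)
qed

section \<open>Contribution of each member to the two dominating sets\<close>

definition excused :: "'a set set \<Rightarrow> 'a set set \<Rightarrow> 'a set \<Rightarrow> 'a set" where
  "excused C Y U = {x \<in> open_ends U. \<exists>y g. E x y \<and> y \<notin> U \<and> g \<in> C \<and> y \<in> g \<and> (special g \<longrightarrow> g \<in> Y)}"

definition excused_by :: "'a set set \<Rightarrow> 'a set \<Rightarrow> 'a set" where
  "excused_by Y U = {x \<in> open_ends U. \<exists>g\<in>Y. \<exists>y\<in>g. E x y}"

text \<open>The constants bound what 3|U| leaves after paying 5|A| + 3|B|. Let k be
  \<open>card U div 3\<close>. A special member outside of \<open>Y\<close> uses k + 1 vertices in
  each set, which leaves k - 2, that is, 3 or 4; in \<open>Y\<close> it uses k + 2 and leaves k - 10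
  \<ge> -5. A stuck member uses k + 1 and leaves k - 5, unless \<open>Y\<close> helps: then k
  vertices leave k + 3 \<ge> 3, and a lone member uses none and leaves 12.\<close>

definition slack :: "'a set set \<Rightarrow> 'a set set \<Rightarrow> 'a set \<Rightarrow> int" where
  "slack C Y U = (if special U then (if U \<in> Y then -5 else if card U = 17 then 3 else 4)
     else if stuck C U then
       (if \<exists>g\<in>Y. reaches U g then (if lone C U then 12 else 3) else - (5 - int (card U div 3)))
     else 0)"

text \<open>Two dominating sets are built simultaneously, with \<open>A\<close> and \<open>B\<close> their parts in \<open>U\<close>. The first one
  lets all ends with a neighbor in a suitable member be dominated from there; the second one avoids
  this except for the neighbors of the members in \<open>Y\<close>. The weights 5 and 3 make every
  member pay for itself, apart from the slack, which sums up to at least 0 for a suitable \<open>Y\<close>.\<close>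

definition serves :: "'a set set \<Rightarrow> 'a set set \<Rightarrow> 'a set \<Rightarrow> 'a set \<Rightarrow> 'a set \<Rightarrow> bool" where
  "serves C Y U A B \<longleftrightarrow> A \<subseteq> U \<and> B \<subseteq> U \<and>
     U - (if card U mod 3 = 0 then {} else excused C Y U) \<subseteq> dominated_by A \<and>
     U - (if card U mod 3 = 1 then excused_by Y U else {}) \<subseteq> dominated_by B \<and>
     (card U mod 3 \<noteq> 1 \<and> (special U \<longrightarrow> U \<in> Y) \<longrightarrow> anchors U \<subseteq> A) \<and>
     (U \<in> Y \<longrightarrow> anchors U \<subseteq> B) \<and>
     5 * int (card A) + 3 * int (card B) + slack C Y U \<le> 3 * int (card U)"

lemma serves_0:
  assumes "card U mod 3 = 0" "ham_path U xs" "Y \<subseteq> {g \<in> C. special g}"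
  shows "\<exists>A B. serves C Y U A B"
proof -
  let ?D = "every_third 1 xs"
  have len: "length xs = card U" by (rule ham_path_length[OF assms(2)])
  have "\<not> special U" "\<not> stuck C U" using assms(1) by (auto simp: special_def stuck_def)
  then have "slack C Y U = 0" "U \<notin> Y" using assms(3) by (auto simp: slack_def)
  moreover have "U \<subseteq> dominated_by ?D" using every_third_1_dominates[OF assms(2)] len assms(1) by simp
  moreover have "?D \<subseteq> U" using every_third_subset[of 1 xs] assms(2) by (simp add: ham_path_def)
  moreover have "anchors U \<subseteq> ?D" using anchors_every_third[OF assms(2)] assms(1) by simp
  moreover have "8 * int (card ?D) \<le> 3 * int (card U)"
  proof -
    obtain k where k: "card U = 3 * k" using assms(1) mult_div_mod_eq[of 3 "card U"] by (metis add.right_neutral)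
    then have "card ?D \<le> k" using card_every_third[of 1 xs] len by simp
    then show ?thesis using k by simp
  qed
  ultimately show ?thesis unfolding serves_def by (intro exI[of _ ?D]) auto
qed

lemma serves_1:
  assumes opt: "optimal_cover C" and U: "U \<in> C" and mod: "card U mod 3 = 1"
    and Y: "Y \<subseteq> {g \<in> C. special g}"
  shows "\<exists>A B. serves C Y U A B"
proof -
  have pc: "path_cover C" using opt by (simp add: optimal_cover_def)
  have UV: "U \<subseteq> V" by (rule path_cover_subset[OF pc U])
  obtain ys where ys: "ham_path U ys" using pc U unfolding path_cover_def by blast
  have "\<not> special U" using mod by (auto simp: special_def)
  then have UY: "U \<notin> Y" and slack: "slack C Y U = (if stuck C U then
       (if \<exists>g\<in>Y. reaches U g then (if lone C U then 12 else 3) else - (5 - int (card U div 3))) else 0)"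
    using Y by (auto simp: slack_def)
  have sub: "excused_by Y U \<subseteq> excused C Y U"
    using Y UY path_cover_disjoint[OF pc U] unfolding excused_by_def excused_def by blast
  have servesI: "serves C Y U A B"
    if "A \<subseteq> U" "B \<subseteq> U" "U - excused C Y U \<subseteq> dominated_by A" "U - excused_by Y U \<subseteq> dominated_by B"
      "5 * int (card A) + 3 * int (card B) + slack C Y U \<le> 3 * int (card U)" for A B
    using that mod UY by (simp add: serves_def)
  define k where "k = card U div 3"
  have k: "card U = 3 * k + 1" using mod mult_div_mod_eq[of 3 "card U"] by (simp add: k_def)
  have third: "U - {x} \<subseteq> dominated_by (every_third 2 (x # xs))" "card (every_third 2 (x # xs)) \<le> k"
    "every_third 2 (x # xs) \<subseteq> U" if "ham_path U (x # xs)" for x xs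
    using every_third_2_all_but_hd[OF that mod] k_def by auto
  have ins: "card (insert x (every_third 2 (x # xs))) \<le> k + 1" "insert x (every_third 2 (x # xs)) \<subseteq> U"
    "U \<subseteq> dominated_by (insert x (every_third 2 (x # xs)))" if "ham_path U (x # xs)" for x xs
  proof -
    show "card (insert x (every_third 2 (x # xs))) \<le> k + 1"
      using card_insert_le_Suc[of x "every_third 2 (x # xs)"] third(2)[OF that] by linarith
    show "insert x (every_third 2 (x # xs)) \<subseteq> U" using third(3)[OF that] that by (auto simp: ham_path_def)
    show "U \<subseteq> dominated_by (insert x (every_third 2 (x # xs)))"
      using third(1)[OF that] dominated_by_mono[OF subset_insertI, of "every_third 2 (x # xs)" x]
      by (auto simp: dominated_by_def)
  qed
  show ?thesis
  proof (cases "cheap U")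
    case True
    then obtain D where D: "D \<subseteq> U" "8 * card D \<le> 3 * card U" "U \<subseteq> dominated_by D" unfolding cheap_def by blast
    have "slack C Y U = 0" using True slack by (simp add: stuck_def)
    then have "serves C Y U D D" using D by (intro servesI) auto
    then show ?thesis by blast
  next
    case nc: False
    show ?thesis
    proof (cases "stuck C U")
      case st: True
      show ?thesis
      proof (cases "\<exists>g\<in>Y. reaches U g")
        case hit: True
        then obtain g x y where g: "g \<in> Y" "reaches U g" "x \<in> open_ends U" "y \<in> g" "E x y"
          unfolding reaches_def by blast
        show ?thesis
        proof (cases "lone C U")
          case True
          then have "card U = 4" "\<forall>v\<in>U. v \<in> open_ends U \<and> (\<exists>y\<in>g. E v y)"
            using g(1,2) Y unfolding lone_def by blast+
          moreover from this have "U \<subseteq> excused_by Y U" using g(1) unfolding excused_by_def by blast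
          ultimately have "serves C Y U {} {}"
            using sub slack st hit True by (intro servesI) auto
          then show ?thesis by blast
        next
          case False
          obtain xs where xs: "ham_path U (x # xs)" using g(3) unfolding open_ends_def by blast
          have "x \<in> excused_by Y U" using g unfolding excused_by_def by blast
          moreover have "slack C Y U = 3" using slack st hit False by simp
          ultimately have "serves C Y U (every_third 2 (x # xs)) (every_third 2 (x # xs))"
            using third[OF xs] sub k by (intro servesI) auto
          then show ?thesis by blast
        qed
      next
        case False
        obtain x xs where xs: "ham_path U (x # xs)" using ys k by (cases ys) (auto simp: ham_path_def)
        have "slack C Y U = - (5 - int k)" using slack st False k_def by simp
        then have "serves C Y U (insert x (every_third 2 (x # xs))) (insert x (every_third 2 (x # xs)))"
          using ins[OF xs] k by (intro servesI) auto
        then show ?thesis by blast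
      qed
    next
      \<comment> \<open>Here the end \<open>x\<close> is free in the first set only: 5k + 3(k + 1)
        \<le> 3(3k + 1), with equality for k = 0.\<close>
      case st: False
      then obtain x y where x: "x \<in> open_ends U" "E x y" "y \<notin> U" "\<not> (\<exists>g\<in>C. special g \<and> y \<in> g)"
        using mod nc unfolding stuck_def by blast
      obtain xs where xs: "ham_path U (x # xs)" using x(1) unfolding open_ends_def by blast
      have "y \<in> V" using x(2) E_in_V2 by blast
      then obtain g where "g \<in> C" "y \<in> g" using pc unfolding path_cover_def partition_on_def by blast
      then have "x \<in> excused C Y U" using x unfolding excused_def by blast
      moreover have "slack C Y U = 0" using slack st by simp
      ultimately have "serves C Y U (every_third 2 (x # xs)) (insert x (every_third 2 (x # xs)))"
        using third[OF xs] ins[OF xs] k by (intro servesI) auto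
      then show ?thesis by blast
    qed
  qed
qed

lemma serves_2:
  assumes opt: "optimal_cover C" and U: "U \<in> C" and mod: "card U mod 3 = 2"
    and Y: "Y \<subseteq> {g \<in> C. special g}"
  shows "\<exists>A B. serves C Y U A B"
proof -
  have pc: "path_cover C" using opt by (simp add: optimal_cover_def)
  have UV: "U \<subseteq> V" by (rule path_cover_subset[OF pc U])
  obtain xs where xs: "ham_path U xs" using pc U unfolding path_cover_def by blast
  have len: "length xs = card U" by (rule ham_path_length[OF xs])
  have ne: "xs \<noteq> []" using len mod by auto
  define k where "k = card U div 3"
  have k: "card U = 3 * k + 2" using mod mult_div_mod_eq[of 3 "card U"] by (simp add: k_def)
  have slack: "slack C Y U = (if special U then (if U \<in> Y then -5 else if card U = 17 then 3 else 4) else 0)"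
    using mod by (simp add: slack_def stuck_def)
  have servesI: "serves C Y U A B"
    if "A \<subseteq> U" "B \<subseteq> U" "U - excused C Y U \<subseteq> dominated_by A" "U \<subseteq> dominated_by B"
      "special U \<longrightarrow> U \<in> Y \<Longrightarrow> anchors U \<subseteq> A" "U \<in> Y \<Longrightarrow> anchors U \<subseteq> B"
      "5 * int (card A) + 3 * int (card B) + slack C Y U \<le> 3 * int (card U)" for A B
    using that mod by (simp add: serves_def)
  let ?B = "every_third 1 xs"
  have B: "?B \<subseteq> U" "card ?B \<le> k + 1" "U \<subseteq> dominated_by ?B"
    using every_third_subset[of 1 xs] xs card_every_third[of 1 xs] len k every_third_1_dominates[OF xs] mod
    by (auto simp: ham_path_def)
  let ?E = "insert (hd xs) (insert (last xs) (every_third 2 xs))"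
  note ends = every_third_2_insert_last[OF xs mod ne]
  have E: "?E \<subseteq> U" "card ?E \<le> k + 2" "U \<subseteq> dominated_by ?E" "anchors U \<subseteq> ?E"
  proof -
    show "?E \<subseteq> U" using ends(3) xs ne by (auto simp: ham_path_def)
    show "card ?E \<le> k + 2"
      using ends(2) card_insert_le_Suc[of "hd xs" "insert (last xs) (every_third 2 xs)"] k_def by linarith
    show "U \<subseteq> dominated_by ?E"
      using ends(1) dominated_by_mono[of "insert (last xs) (every_third 2 xs)" ?E] by (auto simp: dominated_by_def)
    show "anchors U \<subseteq> ?E" using ends(4) by blast
  qed
  show ?thesis
  proof (cases "special U")
    case sp: True
    then have card: "card U = 17 \<or> card U = 20" by (simp add: special_def)
    show ?thesis
    proof (cases "U \<in> Y")
      case True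
      then have "serves C Y U ?E ?E" using E sp slack k card by (intro servesI) auto
      then show ?thesis by blast
    next
      case False
      then have "serves C Y U ?B ?B" using B sp slack k card by (intro servesI) auto
      then show ?thesis by blast
    qed
  next
    case nsp: False
    then have s0: "slack C Y U = 0" and UY: "U \<notin> Y" using slack Y by auto
    show ?thesis
    proof (cases "\<exists>x\<in>open_ends U. \<exists>y. \<exists>g\<in>C. E x y \<and> y \<notin> U \<and> y \<in> g \<and> special g")
      \<comment> \<open>An end next to a special member cannot rely on it if that member is outside
        of \<open>Y\<close>. But then \<open>U\<close> has order 8 and is dominated by three
        vertices that include its anchors, and 8 * 3 = 3 * 8.\<close>
      case True
      then obtain x y g where x: "x \<in> open_ends U" "E x y" "y \<notin> U" "g \<in> C" "y \<in> g" "special g" by blast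
      have g: "U \<noteq> g" "open_ends g = {}" "card g \<in> {17, 20}" using x by (auto simp: special_def)
      obtain zs where zs: "ham_path U (x # zs)" using x(1) unfolding open_ends_def by blast
      note T = neighbor_of_closed_order_17_20[OF opt U x(4) g(1) mod _ _ x(5) g(2,3)]
      have "card U = 8" by (rule T(1)[OF zs x(2)])
      moreover have "self_dominating U"
      proof (rule order_8_self_dominating[OF \<open>card U = 8\<close> UV x(3)])
        show "ham_path U (rev (x # zs))" by (rule ham_path_rev[OF zs])
        show "E (last (rev (x # zs))) y" using x(2) by simp
        show "v \<in> insert y U" if h: "ham_path U hs" "E (last hs) y" "E (hd hs) v" for hs v
        proof -
          have "hs \<noteq> []" using h(1) mod by (auto simp: ham_path_def)
          then obtain p ps where p: "rev hs = p # ps" by (cases "rev hs") auto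
          then have "hs = rev ps @ [p]" by (metis rev.simps(2) rev_rev_ident)
          then have "last hs = p" "last (p # ps) = hd hs" using p last_rev[of hs] \<open>hs \<noteq> []\<close> by auto
          moreover have "ham_path U (p # ps)" using ham_path_rev[OF h(1)] p by simp
          ultimately show ?thesis using T(2)[of p ps v] h by simp
        qed
      qed
      ultimately obtain D where D: "D \<subseteq> U" "anchors U \<subseteq> D" "card D \<le> 3" "U \<subseteq> dominated_by D"
        unfolding anchored_domination_def by auto
      then have "serves C Y U D D" using s0 \<open>card U = 8\<close> by (intro servesI) auto
      then show ?thesis by blast
    next
      case False
      have exc: "open_ends U \<subseteq> excused C Y U"
      proof
        fix x assume x: "x \<in> open_ends U"
        then obtain y where y: "E x y" "y \<notin> U" unfolding open_ends_def by blast
        then obtain g where "g \<in> C" "y \<in> g"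
          using pc E_in_V2 unfolding path_cover_def partition_on_def by blast
        then show "x \<in> excused C Y U" using x y False unfolding excused_def by blast
      qed
      have use: ?thesis if m: "anchored_domination m U (open_ends U)" "5 * m + 3 * (k + 1) \<le> 3 * card U" for m
      proof -
        obtain D where D: "D \<subseteq> U" "anchors U \<subseteq> D" "card D \<le> m" "U - open_ends U \<subseteq> dominated_by D"
          using m(1) unfolding anchored_domination_def by blast
        have "5 * card D + 3 * card ?B \<le> 3 * card U" using D(3) B(2) m(2) by simp
        then have "serves C Y U D ?B" using D B exc s0 UY by (intro servesI) auto
        then show ?thesis by blast
      qed
      \<comment> \<open>The budget 5m + 3(k + 1) \<le> 3(3k + 2) allows m = 0 for k = 0, m = 1 for k
        = 1, m = k + 1 for k from 2 to 6, and m = k + 2 from k = 7 on.\<close>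
      consider "k = 0" | "k = 1" | "2 \<le> k" "k \<le> 6" | "7 \<le> k" by linarith
      then show ?thesis
      proof cases
        case 1
        then have "length xs = Suc (Suc 0)" using len k by simp
        then obtain a b where ab: "xs = [a, b]" by (auto simp only: length_Suc_conv length_0_conv)
        have "anchors U \<subseteq> {}"
          using anchors_every_third[OF xs] mod ab by (auto simp: every_third_def less_Suc_eq)
        moreover have "U \<subseteq> open_ends U"
        proof
          fix v assume "v \<in> U"
          then have v: "v = a \<or> v = b" using xs ab by (auto simp: ham_path_def)
          have "v \<in> V" using \<open>v \<in> U\<close> UV by blast
          then obtain z where "E v z" "z \<noteq> a" "z \<noteq> b" by (rule third_neighbor)
          moreover have "ham_path U [a, b]" "ham_path U [b, a]" using xs ham_path_rev[OF xs] ab by simp_all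
          moreover have "U = {a, b}" using xs ab by (auto simp: ham_path_def)
          ultimately show "v \<in> open_ends U" using v open_endsI by auto
        qed
        ultimately have "anchored_domination 0 U (open_ends U)" unfolding anchored_domination_def by auto
        then show ?thesis using use[of 0] k 1 by simp
      next
        case 2
        then show ?thesis using use[OF order_5_anchored_domination[OF _ UV xs]] k by simp
      next
        case 3
        have "anchored_domination (k + 1) U (open_ends U)"
        proof (cases "open_ends U = {}")
          case True
          have "card U < 17 \<or> card U = 17 \<or> card U = 20"
          proof -
            have "k = 2 \<or> k = 3 \<or> k = 4 \<or> k = 5 \<or> k = 6" using 3 by linarith
            then show ?thesis using k by auto
          qed
          then have "self_dominating U"
            using closed_self_dominating[OF mod UV xs True] nsp True by (auto simp: special_def)
          then show ?thesis using True k_def by simp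
        next
          case False
          then show ?thesis using open_end_anchored_domination[OF mod] k_def by auto
        qed
        then show ?thesis using use k 3 by simp
      next
        case 4
        then have "serves C Y U ?E ?B" using E B s0 UY k by (intro servesI) auto
        then show ?thesis by blast
      qed
    qed
  qed
qed

theorem three_eighths_domination:
  "\<exists>D\<subseteq>V. 8 * card D \<le> 3 * card V \<and> V \<subseteq> dominated_by D"
proof -
  obtain C where opt: "optimal_cover C" using optimal_cover_exists by blast
  then have pc: "path_cover C" by (simp add: optimal_cover_def)
  then have part: "partition_on V C" by (simp add: path_cover_def)
  have finC: "finite C" using part finite_V finite_elements by blast
  have VC: "V = \<Union>C" using part by (simp add: partition_on_def)
  have disjC: "U \<inter> U' = {}" if "U \<in> C" "U' \<in> C" "U \<noteq> U'" for U U' using path_cover_disjoint[OF pc that] .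
  have finU: "finite U" if "U \<in> C" for U using finite_subset[OF path_cover_subset[OF pc that] finite_V] .
  define S where "S = {g \<in> C. special g}"
  define W where "W = {U \<in> C. stuck C U}"
  obtain Y where Y: "Y \<subseteq> S" "0 \<le> (\<Sum>g\<in>S. if g \<in> Y then -5 else if card g = 17 then 3 else 4) +
      (\<Sum>U\<in>W. if \<exists>g\<in>Y. reaches U g then (if lone C U then 12 else 3) else - (5 - int (card U div 3)))"
  proof -
    have "\<exists>Y\<subseteq>S. 0 \<le> (\<Sum>g\<in>S. if g \<in> Y then -5 else (\<lambda>g. if card g = 17 then 3 else 4 :: int) g) +
      (\<Sum>U\<in>W. if \<exists>g\<in>Y. reaches U g then (\<lambda>U. if lone C U then 12 else 3 :: int) U else - (\<lambda>U. 5 - int (card U div 3)) U)"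
    proof (rule accepting_selection)
      show "finite S" "finite W" using finC by (simp_all add: S_def W_def)
      show "5 < (if lone C U then 12 else 3 :: int) \<and> (\<exists>g\<in>S. reaches U g) \<or>
         5 - int (card U div 3) \<le> (\<Sum>g\<in>{g \<in> S. reaches U g}. if card g = 17 then 3 else 4)" if "U \<in> W" for U
        using stuck_weight[OF opt, of U] that unfolding S_def W_def by auto
    qed auto
    then show thesis using that by blast
  qed
  have YS: "Y \<subseteq> {g \<in> C. special g}" using Y(1) by (simp add: S_def)
  have "\<exists>A B. serves C Y U A B" if U: "U \<in> C" for U
  proof (cases "card U" rule: mod_3_cases)
    case 1
    obtain xs where "ham_path U xs" using pc U unfolding path_cover_def by blast
    then show ?thesis using serves_0[OF 1 _ YS] by blast
  next
    case 2
    then show ?thesis using serves_1[OF opt U _ YS] by blast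
  next
    case 3
    then show ?thesis using serves_2[OF opt U _ YS] by blast
  qed
  then obtain A B where AB: "\<And>U. U \<in> C \<Longrightarrow> serves C Y U (A U) (B U)" by metis
  define DA where "DA = \<Union>(A ` C)"
  define DB where "DB = \<Union>(B ` C)"
  have sub: "DA \<subseteq> V" "DB \<subseteq> V" using AB VC unfolding DA_def DB_def serves_def by blast+
  have mono: "dominated_by (A U) \<subseteq> dominated_by DA" "dominated_by (B U) \<subseteq> dominated_by DB" if "U \<in> C" for U
    using that unfolding DA_def DB_def by (intro dominated_by_mono; blast)+
  have domA: "V \<subseteq> dominated_by DA"
  proof
    fix v assume "v \<in> V"
    then obtain U where U: "U \<in> C" "v \<in> U" using VC by blast
    show "v \<in> dominated_by DA"
    proof (cases "card U mod 3 \<noteq> 0 \<and> v \<in> excused C Y U")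
      \<comment> \<open>An excused end is adjacent to an anchor of another member, and the part of
        \<open>DA\<close> in that member contains its anchors whether or not its own ends are
        excused; so there is no circularity.\<close>
      case True
      then obtain y g where g: "v \<in> open_ends U" "E v y" "y \<notin> U" "g \<in> C" "y \<in> g" "special g \<longrightarrow> g \<in> Y"
        unfolding excused_def by blast
      have "U \<noteq> g" using g by blast
      then have "card g mod 3 \<noteq> 1" "y \<in> anchors g"
        using open_end_neighbor_anchor[OF opt U(1) g(4) _ _ g(1,2,5)] True by blast+
      then have "y \<in> A g" using AB[OF g(4)] g(6) unfolding serves_def by blast
      then show ?thesis using g(2,4) E_sym unfolding DA_def dominated_by_def by blast
    next
      case False
      then have "v \<in> dominated_by (A U)" using AB[OF U(1)] U(2) unfolding serves_def by (auto split: if_splits)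
      then show ?thesis using mono(1)[OF U(1)] by blast
    qed
  qed
  have domB: "V \<subseteq> dominated_by DB"
  proof
    fix v assume "v \<in> V"
    then obtain U where U: "U \<in> C" "v \<in> U" using VC by blast
    show "v \<in> dominated_by DB"
    proof (cases "card U mod 3 = 1 \<and> v \<in> excused_by Y U")
      case True
      then obtain y g where g: "v \<in> open_ends U" "E v y" "g \<in> Y" "y \<in> g" unfolding excused_by_def by blast
      have "g \<in> C" "card g mod 3 = 2" using g(3) YS by (auto simp: special_def)
      then have "U \<noteq> g" using True by auto
      then have "y \<in> anchors g"
        using open_end_neighbor_anchor[OF opt U(1) \<open>g \<in> C\<close> _ _ g(1,2,4)] True by simp
      then have "y \<in> B g" using AB[OF \<open>g \<in> C\<close>] g(3) unfolding serves_def by blast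
      then show ?thesis using g(2) \<open>g \<in> C\<close> E_sym unfolding DB_def dominated_by_def by blast
    next
      case False
      then have "v \<in> dominated_by (B U)" using AB[OF U(1)] U(2) unfolding serves_def by (auto split: if_splits)
      then show ?thesis using mono(2)[OF U(1)] by blast
    qed
  qed
  \<comment> \<open>Special members have order 2 modulo 3 and stuck ones order 1, so the slack
    splits into the two sums controlled by the choice of \<open>Y\<close>.\<close>
  have "(\<Sum>U\<in>C. slack C Y U) = (\<Sum>U\<in>C.
      (if special U then (if U \<in> Y then -5 else if card U = 17 then 3 else 4) else 0) +
      (if stuck C U then (if \<exists>g\<in>Y. reaches U g then (if lone C U then 12 else 3) else - (5 - int (card U div 3))) else 0))"
  proof (rule sum.cong[OF refl])
    fix U
    have "\<not> (special U \<and> stuck C U)" by (auto simp: special_def stuck_def)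
    then show "slack C Y U = (if special U then (if U \<in> Y then -5 else if card U = 17 then 3 else 4) else 0) +
      (if stuck C U then (if \<exists>g\<in>Y. reaches U g then (if lone C U then 12 else 3) else - (5 - int (card U div 3))) else 0)"
      unfolding slack_def by (cases "special U"; cases "stuck C U") simp_all
  qed
  also have "\<dots> = (\<Sum>g\<in>S. if g \<in> Y then -5 else if card g = 17 then 3 else 4) +
      (\<Sum>U\<in>W. if \<exists>g\<in>Y. reaches U g then (if lone C U then 12 else 3) else - (5 - int (card U div 3)))"
    unfolding S_def W_def sum.distrib using finC by (simp only: sum.inter_filter)
  finally have slack: "0 \<le> (\<Sum>U\<in>C. slack C Y U)" using Y(2) by simp
  have "(\<Sum>U\<in>C. 5 * int (card (A U)) + 3 * int (card (B U)) + slack C Y U) \<le> (\<Sum>U\<in>C. 3 * int (card U))"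
    using AB unfolding serves_def by (intro sum_mono) blast
  then have "5 * (\<Sum>U\<in>C. int (card (A U))) + 3 * (\<Sum>U\<in>C. int (card (B U))) \<le> 3 * (\<Sum>U\<in>C. int (card U))"
    using slack by (simp only: sum.distrib sum_distrib_left[symmetric])
  moreover have "(\<Sum>U\<in>C. int (card U)) = int (card V)"
    unfolding VC using card_Union_disjoint[of C] finU disjC
    by (subst card_Union_disjoint) (auto simp: pairwise_def disjnt_def)
  moreover have "card DA \<le> (\<Sum>U\<in>C. card (A U))" "card DB \<le> (\<Sum>U\<in>C. card (B U))"
    unfolding DA_def DB_def by (rule card_UN_le[OF finC])+
  then have "int (card DA) \<le> (\<Sum>U\<in>C. int (card (A U)))" "int (card DB) \<le> (\<Sum>U\<in>C. int (card (B U)))"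
    by (simp_all flip: of_nat_sum)
  ultimately have "5 * card DA + 3 * card DB \<le> 3 * card V" by linarith
  \<comment> \<open>A weighted average: were both sets too large, so would be 5|DA| + 3|DB|.\<close>
  then have "8 * card DA \<le> 3 * card V \<or> 8 * card DB \<le> 3 * card V" by linarith
  then show ?thesis using sub domA domB by blast
qed

end

section \<open>Power throttling\<close>

lemma neighborhood_eq: "neighborhood G u = {w. (u, w) \<in> parcs G}"
  by (simp add: neighborhood_def)

lemma closed_neighborhood_subset:
  assumes "pair_graph G" "S \<subseteq> pverts G"
  shows "closed_neighborhood G S \<subseteq> pverts G"
proof -
  interpret pair_graph G by fact
  show ?thesis using assms(2) arc_snd_in_verts by (force simp: closed_neighborhood_def neighborhood_eq)
qed

lemma min_degree_3_graph_pair_graph: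
  assumes "pair_graph G" "min_degree G \<ge> 3"
  shows "min_degree_3_graph (pverts G) (\<lambda>x y. (x, y) \<in> parcs G)"
proof -
  interpret pair_graph G by fact
  have sym: "sym (parcs G)" using pair_sym_arcs by (simp add: symmetric_def)
  show ?thesis
  proof
    show "finite (pverts G)" by (rule pair_finite_verts)
    show "(y, x) \<in> parcs G" if "(x, y) \<in> parcs G" for x y using sym that by (rule symD)
    show "(x, x) \<notin> parcs G" for x using pair_no_loops by fastforce
    show "x \<in> pverts G" if "(x, y) \<in> parcs G" for x y using arc_fst_in_verts[OF that] by simp
    show "3 \<le> card {y. (x, y) \<in> parcs G}" if x: "x \<in> pverts G" for x
    proof -
      have "3 \<le> out_degree (with_proj G) x"
        using assms(2) x pair_finite_verts unfolding min_degree_def by (auto intro: order_trans[OF _ Min_le])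
      moreover have "out_arcs (with_proj G) x = Pair x ` {y. (x, y) \<in> parcs G}"
        by (auto simp: out_arcs_def)
      moreover have "card (Pair x ` {y. (x, y) \<in> parcs G}) = card {y. (x, y) \<in> parcs G}"
        by (rule card_image) (simp add: inj_on_def)
      ultimately show ?thesis by (simp add: out_degree_def)
    qed
  qed
qed

lemma domination_number_le_three_eighths:
  assumes "pair_graph G" "min_degree G \<ge> 3"
  shows "8 * domination_number G \<le> 3 * card (pverts G)"
proof -
  interpret min_degree_3_graph "pverts G" "\<lambda>x y. (x, y) \<in> parcs G"
    by (rule min_degree_3_graph_pair_graph[OF assms])
  obtain D where D: "D \<subseteq> pverts G" "8 * card D \<le> 3 * card (pverts G)" "pverts G \<subseteq> dominated_by D"
    using three_eighths_domination by blast
  have "closed_neighborhood G D = dominated_by D"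
    by (auto simp: closed_neighborhood_def neighborhood_eq dominated_by_def)
  then have "dominating_set G D"
    using D closed_neighborhood_subset[OF assms(1) D(1)] by (auto simp: dominating_set_def)
  moreover have "finite {S. dominating_set G S}"
    using finite_V by (auto simp: dominating_set_def intro: finite_subset[of _ "Pow (pverts G)"])
  ultimately have "domination_number G \<le> card D" unfolding domination_number_def by (intro Min_le) auto
  then show ?thesis using D(2) by linarith
qed

theorem corollary3p14:
  fixes G :: "'a pair_pre_digraph" and n :: nat
  assumes "pair_graph G"
    and "Digraph_Component.connected (with_proj G)"
    and "card (pverts G) = n"
    and "min_degree G \<ge> 3"
    and "real (power_domination_number G) \<ge> 3 * real n / 16"
  shows "product_power_throttling_number G = enat (domination_number G)"
proof -
  interpret pair_graph G by fact
  let ?V = "pverts G"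
  let ?pt = "power_propagation_time G"
  have fin: "finite ?V" by (rule pair_finite_verts)
  \<comment> \<open>Connectedness includes the existence of a vertex, so that a minimum dominating
    set is nonempty and takes part in the minimum.\<close>
  have ne: "?V \<noteq> {}"
    using assms(2) by (simp add: Digraph_Component.connected_def strongly_connected_def mk_symmetric_def)
  have finP: "finite {S. P S \<and> S \<subseteq> ?V}" for P by (rule finite_subset[of _ "Pow ?V"]) (use fin in auto)
  have fin_dom: "finite {S. dominating_set G S}"
    by (rule finite_subset[of _ "Pow ?V"]) (use fin in \<open>auto simp: dominating_set_def\<close>)
  have fin_pd: "finite {S. power_dominating_set G S}"
    by (rule finite_subset[of _ "Pow ?V"]) (use fin in \<open>auto simp: power_dominating_set_def\<close>)
  have dom_V: "closed_neighborhood G ?V = ?V"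
    using closed_neighborhood_subset[OF assms(1), of ?V] by (auto simp: closed_neighborhood_def)
  have least: "\<exists>t. 0 < t \<and> observed G S t = ?V \<and> ?pt S = enat t" if S: "power_dominating_set G S" for S
  proof -
    obtain t where "observed G S t = ?V" using S by (auto simp: power_dominating_set_def)
    have "\<exists>t. 0 < t \<and> observed G S t = ?V"
    proof (cases "t = 0")
      case True
      then have "observed G S (Suc 0) = ?V" using \<open>observed G S t = ?V\<close> dom_V by simp
      then show ?thesis by blast
    next
      case False
      then show ?thesis using \<open>observed G S t = ?V\<close> by blast
    qed
    then have "0 < (LEAST t. 0 < t \<and> observed G S t = ?V) \<and> observed G S (LEAST t. 0 < t \<and> observed G S t = ?V) = ?V"
      by (rule LeastI_ex)
    then show ?thesis using S by (auto simp: power_propagation_time_def)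
  qed
  have lower: "enat (domination_number G) \<le> enat (card S) * ?pt S" if S: "S \<noteq> {}" "S \<subseteq> ?V" for S
  proof (cases "power_dominating_set G S")
    case False
    \<comment> \<open>Since 0 * \<infinity> = 0 in \<open>enat\<close>, the product is infinite only
      because \<open>S\<close> is nonempty.\<close>
    have "card S \<noteq> 0" using S fin finite_subset by fastforce
    then have "enat (card S) * ?pt S = \<infinity>"
      using False by (simp add: power_propagation_time_def zero_enat_def[symmetric] imult_is_infinity enat_0_iff)
    then show ?thesis by simp
  next
    case True
    obtain t where t: "0 < t" "observed G S t = ?V" "?pt S = enat t" using least[OF True] by blast
    have "domination_number G \<le> card S * t"
    proof (cases "t = 1")
      case True
      then have "dominating_set G S" using t(2) S(2) by (simp add: dominating_set_def)
      then have "domination_number G \<le> card S" unfolding domination_number_def using fin_dom by (intro Min_le) auto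
      then show ?thesis using True by simp
    next
      case False
      then have "2 \<le> t" using t(1) by simp
      have "power_domination_number G \<le> card S"
        unfolding power_domination_number_def using fin_pd True by (intro Min_le) auto
      moreover have "3 * n \<le> 16 * power_domination_number G" using assms(5) by linarith
      moreover have "8 * domination_number G \<le> 3 * n"
        using domination_number_le_three_eighths[OF assms(1,4)] assms(3) by simp
      ultimately have "domination_number G \<le> card S * 2" by linarith
      also have "\<dots> \<le> card S * t" using \<open>2 \<le> t\<close> by simp
      finally show ?thesis .
    qed
    then show ?thesis using t(3) by simp
  qed
  \<comment> \<open>A minimum dominating set has propagation time 1, so it attains the lower
    bound.\<close>
  have "dominating_set G ?V" using dom_V by (simp add: dominating_set_def)
  then have "domination_number G \<in> card ` {S. dominating_set G S}"
    unfolding domination_number_def using fin_dom by (intro Min_in) auto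
  then obtain S where S: "dominating_set G S" "card S = domination_number G" by auto
  then have "S \<subseteq> ?V" "S \<noteq> {}" "observed G S 1 = ?V"
    using ne by (auto simp: dominating_set_def closed_neighborhood_def)
  moreover from this have "power_dominating_set G S" unfolding power_dominating_set_def by blast
  moreover from calculation have "(LEAST t. 0 < t \<and> observed G S t = ?V) = 1"
    by (intro Least_equality) auto
  ultimately have attained: "S \<in> {S. S \<noteq> {} \<and> S \<subseteq> ?V}" "enat (domination_number G) = enat (card S) * ?pt S"
    using S(2) by (auto simp: power_propagation_time_def)
  show ?thesis
    unfolding product_power_throttling_number_def
  proof (rule Min_eqI)
    show "finite ((\<lambda>S. enat (card S) * ?pt S) ` {S. S \<noteq> {} \<and> S \<subseteq> ?V})"
      by (intro finite_imageI finP)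
    show "enat (domination_number G) \<le> y"
      if "y \<in> (\<lambda>S. enat (card S) * ?pt S) ` {S. S \<noteq> {} \<and> S \<subseteq> ?V}" for y
      using that lower by auto
    show "enat (domination_number G) \<in> (\<lambda>S. enat (card S) * ?pt S) ` {S. S \<noteq> {} \<and> S \<subseteq> ?V}"
      using attained by blast
  qed
qed

end
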